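(* Let $\varphi:\mathcal C_2\to\mathcal C_2$ be the homeomorphism represented by the binary transducer $T^\varphi$ given in the context, and let $H_i=F^{\varphi^i}$ for $i\ge0$. Let $i\ge0$. If $K$ is a subgroup with $H_i\le K\le F$, then $K=H_j$ for some $0\le j\le i$.
   Context: $\mathcal C_2=\{0,1\}^{\mathbb N}$ with the lexicographic order. Thompson's group $F$ is the group of order-preserving homeomorphisms $f$ of $\mathcal C_2$ for which there are finite complete prefix codes $\{u_1<\dots<u_k\}$, $\{v_1<\dots<v_k\}$ of binary words (complete: the cylinders $u_i\mathcal C_2$ partition $\mathcal C_2$) with $f(u_i\omega)=v_i\omega$. $T^\varphi$ has states $\mathsf L,\mathsf R,\mathsf A,\mathsf B$, initial state $\mathsf L$; an entry $i\mid w\to s'$ in the row of $s$ means that in state $s$ on input $i$ it outputs the word $w$ ($\varepsilon$ the empty word) and moves to $s'$: $\mathsf L$: $0\mid0\to\mathsf L$, $1\mid1\to\mathsf R$; $\mathsf R$: $0\mid0\to\mathsf A$, $1\mid1\to\mathsf R$; $\mathsf A$: $0\mid00\to\mathsf A$, $1\mid\varepsilon\to\mathsf B$; $\mathsf B$: $0\mid01\to\mathsf A$, $1\mid1\to\mathsf R$. $\varphi(\omega)$ is the infinite output on input $\omega$ from $\mathsf L$; $\varphi$ is an order-preserving homeomorphism. $\varphi^i$ is the $i$-th iterate, and $F^{\varphi^i}=\{\varphi^i\circ f\circ\varphi^{-i}:f\in F\}$. One has $F=H_0\ge H_1\ge H_2\ge\cdots$. *)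

theory Defs
  imports "HOL-Analysis.Function_Topology" "HOL-Algebra.Bij"
    "HOL-Library.Fun_Lexorder" "HOL-Library.Sublist" "HOL-Library.Disjoint_Sets"
begin

text \<open>
  Cantor space is \<open>nat \<Rightarrow> bool\<close> with its product topology, the letters 0 and 1 being
  \<^term>\<open>False\<close> and \<^term>\<open>True\<close>. The order instance on \<open>nat \<Rightarrow> bool\<close> is the pointwise one, so
  the lexicographic order is written \<^const>\<open>less_fun\<close>, and its analogue on words
  \<^const>\<open>ord_class.lexordp\<close>.
\<close>

type_synonym cantor = "nat \<Rightarrow> bool"

definition wcat :: "bool list \<Rightarrow> cantor \<Rightarrow> cantor" where
  "wcat u \<omega> = (\<lambda>n. if n < length u then u ! n else \<omega> (n - length u))"

definition cylinder :: "bool list \<Rightarrow> cantor set" where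
  "cylinder u = range (wcat u)"

definition complete_prefix_code :: "bool list set \<Rightarrow> bool" where
  "complete_prefix_code U \<longleftrightarrow>
     finite U \<and> pairwise (\<lambda>u v. \<not> prefix u v) U \<and> partition_on UNIV (cylinder ` U)"

definition thompson_F :: "(cantor \<Rightarrow> cantor) set" where
  "thompson_F = {f. homeomorphic_map euclidean euclidean f \<and> monotone less_fun less_fun f \<and>
     (\<exists>us vs. complete_prefix_code (set us) \<and> complete_prefix_code (set vs) \<and>
        sorted_wrt ord_class.lexordp us \<and> sorted_wrt ord_class.lexordp vs \<and>
        length us = length vs \<and>
        (\<forall>i<length us. \<forall>\<omega>. f (wcat (us ! i) \<omega>) = wcat (vs ! i) \<omega>))}"

datatype state = SL | SR | SA | SB

fun T_phi :: "state \<Rightarrow> bool \<Rightarrow> bool list \<times> state" where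
  "T_phi SL False = ([False], SL)"
| "T_phi SL True  = ([True], SR)"
| "T_phi SR False = ([False], SA)"
| "T_phi SR True  = ([True], SR)"
| "T_phi SA False = ([False, False], SA)"
| "T_phi SA True  = ([], SB)"
| "T_phi SB False = ([False, True], SA)"
| "T_phi SB True  = ([True], SR)"

text \<open>The word output on the first \<open>n\<close> letters of \<open>\<omega>\<close>, and the state then reached.\<close>

primrec run :: "cantor \<Rightarrow> nat \<Rightarrow> bool list \<times> state" where
  "run \<omega> 0 = ([], SL)"
| "run \<omega> (Suc n) =
     (let (w, s) = run \<omega> n; (w', s') = T_phi s (\<omega> n) in (w @ w', s'))"

text \<open>
  The finite outputs form a chain of prefixes of unbounded length; the letter \<open>k\<close> of their limit
  is read off the first one that is long enough.
\<close>

definition phi :: "cantor \<Rightarrow> cantor" where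
  "phi \<omega> = (\<lambda>k. fst (run \<omega> (LEAST n. k < length (fst (run \<omega> n)))) ! k)"

lemma run_prefix: "m \<le> n \<Longrightarrow> prefix (fst (run \<omega> m)) (fst (run \<omega> n))"
proof (induction n rule: dec_induct)
  case (step n)
  then show ?case
    by (auto simp: split_beta Let_def intro: prefix_order.trans)
qed simp

text \<open>The empty word is output only on the way to \<^const>\<open>SB\<close>, and never from \<^const>\<open>SB\<close>.\<close>

lemma run_unbounded: "\<exists>n. k < length (fst (run \<omega> n))"
proof -
  have ne: "fst (T_phi s a) \<noteq> [] \<or> snd (T_phi s a) = SB" for s a
    by (cases s; cases a) auto
  have ne': "fst (T_phi SB a) \<noteq> []" for a
    by (cases a) auto
  have "k \<le> length (fst (run \<omega> (2 * k)))" for k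
  proof (induction k)
    case (Suc k)
    obtain w s where ws: "run \<omega> (2 * k) = (w, s)" by fastforce
    obtain w1 s1 where t1: "T_phi s (\<omega> (2 * k)) = (w1, s1)" by fastforce
    obtain w2 s2 where t2: "T_phi s1 (\<omega> (Suc (2 * k))) = (w2, s2)" by fastforce
    have "w1 \<noteq> [] \<or> w2 \<noteq> []"
      using ne[of s "\<omega> (2 * k)"] ne'[of "\<omega> (Suc (2 * k))"] t1 t2 by auto
    then have "length w1 + length w2 \<ge> 1"
      by (cases w1; cases w2) auto
    then show ?case
      using Suc ws t1 t2 by simp
  qed simp
  from this[of "Suc k"] show ?thesis
    by (intro exI[of _ "2 * Suc k"]) linarith
qed

lemma phi_nth:
  assumes "k < length (fst (run \<omega> n))"
  shows "phi \<omega> k = fst (run \<omega> n) ! k"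
proof -
  let ?m = "LEAST n. k < length (fst (run \<omega> n))"
  have "?m \<le> n" "k < length (fst (run \<omega> ?m))"
    using assms by (auto intro: Least_le LeastI)
  then show ?thesis
    using run_prefix[of ?m n \<omega>] by (auto simp: phi_def prefix_def nth_append)
qed

definition H_group :: "nat \<Rightarrow> (cantor \<Rightarrow> cantor) set" where
  "H_group i = {(phi ^^ i) \<circ> f \<circ> inv_into UNIV (phi ^^ i) | f. f \<in> thompson_F}"

end

theory Submission
  imports Defs
begin

text \<open>
  Membership in \<open>F\<close> is local: \<open>f\<close> has to be an order automorphism of Cantor space that replaces
  prefixes near every point. After a letter 1 the transducer is in the state \<open>SR\<close>, after a
  further 0 in \<open>SA\<close>, where it doubles runs of zeros; hence \<open>H\<^sub>i\<close> controls the lengths of runs of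
  zeros modulo \<open>2\<^sup>i\<close>. Let \<open>H\<^sub>i \<le> K \<le> F\<close>. If \<open>K \<le> H\<^sub>1\<close>, conjugate by \<open>\<phi>\<^sup>-\<^sup>1\<close> and induct. Otherwise \<open>K\<close>
  shifts the parity of some run of zeros, so it contains an element replacing the prefix 010 by 0100,
  and it remains to see that this forces \<open>K = F\<close>.

  Two elements of \<open>K\<close> that agree at a dyadic cut can be glued there, up to an error near the left
  end point: the elements of \<open>H\<^sub>i\<close> supported on one side of the cut suffice to remove the overlap. By
  gluing, \<open>K\<close> identifies all words that extend 01, and it contains approximations of the basic
  rotation \<open>x\<close> (00 to 0, 01 to 10, 1 to 11) acting inside such a word. Their errors cancel in
  commutators, so \<open>K\<close> contains the quotients of two such rotations, and the pentagon relation
  \<open>x\<^sup>2 = x\<^sub>1 x x\<^sub>0\<close>, whose two sides have different lengths, yields the rotations themselves. They generate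
  the copy of \<open>F\<close> that acts inside 01; every element of \<open>F\<close> that is trivial near both end points is
  conjugate into this copy by \<open>H\<^sub>i\<close>, and \<open>H\<^sub>i\<close> realises all behaviours near the end points.
\<close>

text \<open>The notation \<open>inv\<close> is taken by group inverses.\<close>

abbreviation finv :: "('a \<Rightarrow> 'b) \<Rightarrow> 'b \<Rightarrow> 'a" where
  "finv f \<equiv> inv_into UNIV f"

section \<open>Words, cylinders and the lexicographic order\<close>

definition scons :: "bool \<Rightarrow> cantor \<Rightarrow> cantor" (infixr "##" 65) where
  "a ## \<omega> = case_nat a \<omega>"

definition stl :: "cantor \<Rightarrow> cantor" where
  "stl \<omega> = (\<lambda>n. \<omega> (Suc n))"

lemma scons_nth [simp]: "(a ## \<omega>) 0 = a" "(a ## \<omega>) (Suc n) = \<omega> n"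
  by (simp_all add: scons_def)

lemma stl_scons [simp]: "stl (a ## \<omega>) = \<omega>"
  by (simp add: stl_def)

lemma scons_collapse [simp]: "\<omega> 0 ## stl \<omega> = \<omega>"
  by (auto simp: fun_eq_iff scons_def stl_def split: nat.split)

lemma scons_inject [simp]: "a ## x = b ## y \<longleftrightarrow> a = b \<and> x = y"
proof
  assume "a ## x = b ## y"
  from arg_cong[OF this, of "\<lambda>\<omega>. \<omega> 0"] arg_cong[OF this, of stl] show "a = b \<and> x = y"
    by simp
qed simp

lemma cantor_cases: obtains a x where "\<omega> = a ## x"
  using scons_collapse[of \<omega>] by metis

lemma wcat_Nil [simp]: "wcat [] \<omega> = \<omega>"
  by (simp add: wcat_def)

lemma wcat_Cons [simp]: "wcat (a # u) \<omega> = a ## wcat u \<omega>"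
  by (auto simp: wcat_def fun_eq_iff scons_def split: nat.split)

lemma wcat_append [simp]: "wcat (u @ v) \<omega> = wcat u (wcat v \<omega>)"
  by (induction u) auto

lemma wcat_inject [simp]: "wcat u x = wcat u y \<longleftrightarrow> x = y"
  by (induction u) auto

lemma wcat_nth_less: "n < length u \<Longrightarrow> wcat u \<omega> n = u ! n"
  by (simp add: wcat_def)

lemma cylinder_iff: "x \<in> cylinder u \<longleftrightarrow> (\<exists>\<omega>. x = wcat u \<omega>)"
  by (auto simp: cylinder_def)

lemma cylinderE:
  assumes "x \<in> cylinder u"
  obtains \<omega> where "x = wcat u \<omega>"
  using assms by (auto simp: cylinder_iff)

lemma cylinder_Nil [simp]: "cylinder [] = UNIV"
  by (auto simp: cylinder_iff)

lemma scons_in_cylinder [simp]: "a ## x \<in> cylinder (b # u) \<longleftrightarrow> a = b \<and> x \<in> cylinder u"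
  by (auto simp: cylinder_iff)

lemma wcat_in_cylinder [simp]: "wcat u x \<in> cylinder (u @ v) \<longleftrightarrow> x \<in> cylinder v"
  by (induction u) auto

lemma wcat_in_cylinder_self [simp]: "wcat u x \<in> cylinder u"
  by (auto simp: cylinder_iff)

lemma cylinder_append_subset: "cylinder (u @ v) \<subseteq> cylinder u"
  by (auto simp: cylinder_iff)

lemma cylinder_comparable:
  "x \<in> cylinder u \<Longrightarrow> x \<in> cylinder v \<Longrightarrow> prefix u v \<or> prefix v u"
proof (induction u arbitrary: v x)
  case (Cons a u)
  then show ?case
    by (cases v; cases x rule: cantor_cases) auto
qed simp

lemma cylinder_length_unique:
  "x \<in> cylinder u \<Longrightarrow> x \<in> cylinder v \<Longrightarrow> length u = length v \<Longrightarrow> u = v"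
  using cylinder_comparable[of x u v] by (auto simp: prefix_def)

lemma in_cylinder_of_length: "\<exists>u. length u = n \<and> x \<in> cylinder u"
proof (induction n arbitrary: x)
  case (Suc n)
  obtain a y where x: "x = a ## y"
    by (rule cantor_cases)
  obtain u where "length u = n" "y \<in> cylinder u"
    using Suc by blast
  then show ?case
    by (intro exI[of _ "a # u"]) (simp add: x)
qed simp

lemma less_fun_scons [simp]:
  "less_fun (a ## x) (b ## y) \<longleftrightarrow> \<not> a \<and> b \<or> a = b \<and> less_fun x y"
proof
  assume "less_fun (a ## x) (b ## y)"
  then obtain k where k: "(a ## x) k < (b ## y) k" "\<And>k'. k' < k \<Longrightarrow> (a ## x) k' = (b ## y) k'"
    by (auto elim: less_funE)
  show "\<not> a \<and> b \<or> a = b \<and> less_fun x y"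
  proof (cases k)
    case 0
    then show ?thesis using k by simp
  next
    case (Suc n)
    have "x k' = y k'" if "k' < n" for k'
      using k(2)[of "Suc k'"] that Suc by simp
    then show ?thesis
      using k(1) k(2)[of 0] Suc by (auto simp: less_fun_def)
  qed
next
  assume "\<not> a \<and> b \<or> a = b \<and> less_fun x y"
  then show "less_fun (a ## x) (b ## y)"
  proof
    assume "\<not> a \<and> b"
    then show ?thesis
      by (auto simp: less_fun_def intro!: exI[of _ 0])
  next
    assume *: "a = b \<and> less_fun x y"
    then obtain k where k: "x k < y k" "\<And>k'. k' < k \<Longrightarrow> x k' = y k'"
      by (auto elim: less_funE)
    have "(a ## x) k' = (b ## y) k'" if "k' < Suc k" for k'
      using that * k(2) by (cases k') auto
    then show ?thesis
      using k(1) by (auto simp: less_fun_def intro!: exI[of _ "Suc k"])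
  qed
qed

lemma less_fun_wcat [simp]: "less_fun (wcat u x) (wcat u y) \<longleftrightarrow> less_fun x y"
  by (induction u) auto

lemma less_fun_irreflexive [simp]: "\<not> less_fun (x :: cantor) x"
  by (rule less_fun_irrefl)

lemma cantor_neq_split:
  fixes x y :: cantor
  assumes "x \<noteq> y"
  obtains u a x' y' where "x = wcat u (a ## x')" "y = wcat u ((\<not> a) ## y')"
proof -
  have "\<exists>u a x' y'. x = wcat u (a ## x') \<and> y = wcat u ((\<not> a) ## y')"
    if "x k \<noteq> y k" for k
    using that
  proof (induction k arbitrary: x y)
    case 0
    then have "y 0 = (\<not> x 0)" by auto
    then have "y = wcat [] ((\<not> x 0) ## stl y)"
      using scons_collapse[of y] by (simp del: scons_collapse)
    moreover have "x = wcat [] (x 0 ## stl x)" by simp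
    ultimately show ?case by blast
  next
    case (Suc k)
    show ?case
    proof (cases "x 0 = y 0")
      case True
      obtain u a x' y' where "stl x = wcat u (a ## x')" "stl y = wcat u ((\<not> a) ## y')"
        using Suc.IH[of "stl x" "stl y"] Suc.prems by (auto simp: stl_def)
      then have "x = wcat (x 0 # u) (a ## x')" "y = wcat (x 0 # u) ((\<not> a) ## y')"
        using True scons_collapse[of x] scons_collapse[of y] by simp_all
      then show ?thesis by blast
    next
      case False
      then have "y 0 = (\<not> x 0)" by auto
      then have "y = wcat [] ((\<not> x 0) ## stl y)"
        using scons_collapse[of y] by (simp del: scons_collapse)
      moreover have "x = wcat [] (x 0 ## stl x)" by simp
      ultimately show ?thesis by blast
    qed
  qed
  moreover obtain k where "x k \<noteq> y k"
    using assms by auto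
  ultimately show ?thesis
    using that by blast
qed

lemma less_fun_split:
  assumes "less_fun x (y :: cantor)"
  obtains u x' y' where "x = wcat u (False ## x')" "y = wcat u (True ## y')"
proof -
  have "x \<noteq> y" using assms by auto
  then obtain u a x' y' where *: "x = wcat u (a ## x')" "y = wcat u ((\<not> a) ## y')"
    by (rule cantor_neq_split)
  with assms have "\<not> a" by auto
  with * that show ?thesis by simp
qed

lemma less_fun_total: "less_fun x y \<or> x = y \<or> less_fun y (x :: cantor)"
proof (cases "x = y")
  case False
  then obtain u a x' y' where *: "x = wcat u (a ## x')" "y = wcat u ((\<not> a) ## y')"
    by (rule cantor_neq_split)
  then show ?thesis by (cases a) auto
qed simp

definition zeros :: cantor where "zeros = (\<lambda>_. False)"
definition ones :: cantor where "ones = (\<lambda>_. True)"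

lemma scons_zeros [simp]: "False ## zeros = zeros"
  by (auto simp: fun_eq_iff scons_def zeros_def split: nat.split)

lemma scons_ones [simp]: "True ## ones = ones"
  by (auto simp: fun_eq_iff scons_def ones_def split: nat.split)

lemma scons_eq_zeros [simp]: "a ## x = zeros \<longleftrightarrow> \<not> a \<and> x = zeros" "zeros = a ## x \<longleftrightarrow> \<not> a \<and> zeros = x"
  using scons_inject[of a x False zeros] scons_inject[of False zeros a x] by simp_all

lemma scons_eq_ones [simp]: "a ## x = ones \<longleftrightarrow> a \<and> x = ones" "ones = a ## x \<longleftrightarrow> a \<and> ones = x"
  using scons_inject[of a x True ones] scons_inject[of True ones a x] by simp_all

lemma wcat_eq_zeros: "wcat u x = zeros \<longleftrightarrow> u = replicate (length u) False \<and> x = zeros"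
  by (induction u) auto

lemma wcat_eq_ones: "wcat u x = ones \<longleftrightarrow> u = replicate (length u) True \<and> x = ones"
  by (induction u) auto

lemma wcat_replicate_zeros [simp]: "wcat (replicate n False) zeros = zeros"
  by (induction n) auto

lemma wcat_replicate_ones [simp]: "wcat (replicate n True) ones = ones"
  by (induction n) auto

lemma zeros_least: "\<not> less_fun x zeros"
  by (auto simp: less_fun_def zeros_def)

lemma ones_greatest: "\<not> less_fun ones x"
  by (auto simp: less_fun_def ones_def)

lemma zeros_in_cylinder: "zeros \<in> cylinder u \<longleftrightarrow> u = replicate (length u) False"
  by (metis cylinder_iff wcat_eq_zeros)

lemma ones_in_cylinder: "ones \<in> cylinder u \<longleftrightarrow> u = replicate (length u) True"
  by (metis cylinder_iff wcat_eq_ones)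

text \<open>Cantor space has gaps: no point lies strictly between u0111... and u1000.... An order
  automorphism preserves gaps, so its value on one side of a gap determines the value on the other.
  This is how maps are later seen to agree at cuts.\<close>

lemma less_below_successor:
  "less_fun y (wcat u (True ## zeros)) \<longleftrightarrow> less_fun y (wcat u (False ## ones)) \<or> y = wcat u (False ## ones)"
proof (induction u arbitrary: y)
  case Nil
  obtain a x where "y = a ## x" by (rule cantor_cases)
  then show ?case
    using zeros_least ones_greatest less_fun_total[of x ones] by auto
next
  case (Cons b u)
  obtain a x where "y = a ## x" by (rule cantor_cases)
  then show ?case
    using Cons[of x] by auto
qed

section \<open>Prefix replacements\<close>

definition maps_cyl :: "(cantor \<Rightarrow> cantor) \<Rightarrow> bool list \<Rightarrow> bool list \<Rightarrow> bool" where
  "maps_cyl f u v \<longleftrightarrow> (\<forall>\<omega>. f (wcat u \<omega>) = wcat v \<omega>)"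

lemma maps_cylD: "maps_cyl f u v \<Longrightarrow> f (wcat u \<omega>) = wcat v \<omega>"
  by (simp add: maps_cyl_def)

lemma maps_cyl_append: "maps_cyl f u v \<Longrightarrow> maps_cyl f (u @ w) (v @ w)"
  by (simp add: maps_cyl_def)

lemma maps_cyl_id: "maps_cyl id u u"
  by (simp add: maps_cyl_def)

lemma maps_cyl_comp: "maps_cyl f u v \<Longrightarrow> maps_cyl g v w \<Longrightarrow> maps_cyl (g \<circ> f) u w"
  by (simp add: maps_cyl_def)

lemma maps_cyl_inv: "bij f \<Longrightarrow> maps_cyl f u v \<Longrightarrow> maps_cyl (finv f) v u"
  by (metis maps_cyl_def bij_inv_eq_iff)

definition order_auto :: "(cantor \<Rightarrow> cantor) \<Rightarrow> bool" where
  "order_auto f \<longleftrightarrow> bij f \<and> monotone less_fun less_fun f"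

lemma order_auto_bij: "order_auto f \<Longrightarrow> bij f"
  by (simp add: order_auto_def)

lemma order_auto_less: "order_auto f \<Longrightarrow> less_fun (f x) (f y) \<longleftrightarrow> less_fun x y"
  unfolding order_auto_def monotone_def
  by (metis less_fun_asym less_fun_irreflexive less_fun_total)

lemma order_auto_id: "order_auto id"
  by (simp add: order_auto_def monotone_def)

lemma order_auto_comp: "order_auto f \<Longrightarrow> order_auto g \<Longrightarrow> order_auto (g \<circ> f)"
  by (auto simp: order_auto_def monotone_def intro: bij_comp)

lemma order_auto_inv: "order_auto f \<Longrightarrow> order_auto (finv f)"
  using order_auto_less[of f]
  by (auto simp: order_auto_def monotone_def bij_imp_bij_inv) (metis bij_inv_eq_iff)

lemma order_auto_funpow: "order_auto f \<Longrightarrow> order_auto (f ^^ n)"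
  by (induction n) (auto simp: order_auto_id order_auto_comp simp flip: id_def)

lemma order_auto_inv_inv [simp]: "order_auto f \<Longrightarrow> finv f (f x) = x" "order_auto f \<Longrightarrow> f (finv f x) = x"
  by (auto simp: order_auto_def bij_is_inj bij_is_surj surj_f_inv_f)

lemma order_auto_less_finv: "order_auto f \<Longrightarrow> less_fun (finv f y) x \<longleftrightarrow> less_fun y (f x)"
  using order_auto_less[of f "finv f y" x] by simp

lemma order_auto_finv_eq: "order_auto f \<Longrightarrow> finv f y = x \<longleftrightarrow> y = f x"
  by auto

lemma order_auto_zeros:
  assumes "order_auto f"
  shows "f zeros = zeros"
  using less_fun_total[of zeros "f zeros"] assms order_auto_less_finv[of f zeros zeros]
  by (auto simp: zeros_least)

lemma order_auto_ones:
  assumes "order_auto f"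
  shows "f ones = ones"
  using less_fun_total[of ones "f ones"] assms order_auto_less[of f ones "finv f ones"]
  by (auto simp: ones_greatest)

lemma order_auto_successor:
  assumes f: "order_auto f" and "f (wcat u (False ## ones)) = wcat v (False ## ones)"
  shows "f (wcat u (True ## zeros)) = wcat v (True ## zeros)"
proof -
  \<comment> \<open>In a total order a point is determined by the set of points below it.\<close>
  have *: "less_fun (f y) (f (wcat u (True ## zeros))) \<longleftrightarrow> less_fun (f y) (wcat v (True ## zeros))" for y
    using assms order_auto_bij[OF f, THEN bij_is_inj]
    by (simp add: order_auto_less less_below_successor flip: assms(2))
       (auto simp: inj_eq)
  then have "less_fun y (f (wcat u (True ## zeros))) \<longleftrightarrow> less_fun y (wcat v (True ## zeros))" for y
    using *[of "finv f y"] f by simp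
  then show ?thesis
    by (metis less_fun_irreflexive less_fun_total)
qed

lemma order_auto_predecessor:
  assumes f: "order_auto f" and "f (wcat u (True ## zeros)) = wcat v (True ## zeros)"
  shows "f (wcat u (False ## ones)) = wcat v (False ## ones)"
proof -
  let ?a = "f (wcat u (False ## ones))" and ?b = "wcat v (False ## ones)"
  have *: "less_fun y ?a \<or> y = ?a \<longleftrightarrow> less_fun y ?b \<or> y = ?b" for y
  proof -
    have "less_fun y ?a \<or> y = ?a \<longleftrightarrow> less_fun (finv f y) (wcat u (True ## zeros))"
      using f by (auto simp: less_below_successor order_auto_less_finv order_auto_finv_eq)
    also have "\<dots> \<longleftrightarrow> less_fun y (wcat v (True ## zeros))"
      using f assms(2) by (simp add: order_auto_less_finv)
    finally show ?thesis by (simp add: less_below_successor)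
  qed
  show ?thesis
    using *[of ?a] *[of ?b] by (metis less_fun_asym)
qed

text \<open>Only a replacement near each point is demanded, not a finite code, so closure under
  inverse and composition needs no common refinement of codes. Compactness supplies the code in
  \<open>pl_auto_imp_thompson_F\<close>.\<close>

definition pl_auto :: "(cantor \<Rightarrow> cantor) \<Rightarrow> bool" where
  "pl_auto f \<longleftrightarrow> order_auto f \<and> (\<forall>x. \<exists>u v. x \<in> cylinder u \<and> maps_cyl f u v)"

lemma pl_auto_order_auto: "pl_auto f \<Longrightarrow> order_auto f"
  by (simp add: pl_auto_def)

lemma pl_autoE:
  assumes "pl_auto f"
  obtains u v where "x \<in> cylinder u" "maps_cyl f u v"
  using assms unfolding pl_auto_def by blast

lemma pl_auto_id: "pl_auto id"
  unfolding pl_auto_def using order_auto_id maps_cyl_id by (metis UNIV_I cylinder_Nil)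

lemma pl_auto_inv:
  assumes "pl_auto f"
  shows "pl_auto (finv f)"
  unfolding pl_auto_def
proof (intro conjI allI)
  have f: "order_auto f" using assms by (simp add: pl_auto_def)
  then show "order_auto (finv f)" by (rule order_auto_inv)
  fix x
  obtain u v where uv: "finv f x \<in> cylinder u" "maps_cyl f u v"
    using assms by (rule pl_autoE)
  then have "x \<in> cylinder v"
    using f by (metis cylinder_iff maps_cyl_def order_auto_inv_inv(2))
  moreover have "maps_cyl (finv f) v u"
    using uv f by (simp add: maps_cyl_inv order_auto_bij)
  ultimately show "\<exists>u v. x \<in> cylinder u \<and> maps_cyl (finv f) u v" by blast
qed

lemma pl_auto_comp:
  assumes "pl_auto f" "pl_auto g"
  shows "pl_auto (g \<circ> f)"
  unfolding pl_auto_def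
proof (intro conjI allI)
  show "order_auto (g \<circ> f)"
    using assms by (simp add: pl_auto_def order_auto_comp)
  fix x
  obtain u v where uv: "x \<in> cylinder u" "maps_cyl f u v"
    using assms(1) by (rule pl_autoE)
  obtain u' v' where uv': "f x \<in> cylinder u'" "maps_cyl g u' v'"
    using assms(2) by (rule pl_autoE)
  have fx: "f x \<in> cylinder v"
    using uv by (auto simp: cylinder_iff maps_cyl_def)
  \<comment> \<open>Both \<open>v\<close> and \<open>u'\<close> are prefixes of \<open>f x\<close>,
    so one extends the other, and the replacement with the shorter word is refined.\<close>
  from cylinder_comparable[OF this uv'(1)]
  show "\<exists>u v. x \<in> cylinder u \<and> maps_cyl (g \<circ> f) u v"
  proof
    assume "prefix v u'"
    then obtain s where s: "u' = v @ s" by (auto simp: prefix_def)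
    have "x \<in> cylinder (u @ s)"
      using uv uv'(1) s by (auto simp: cylinder_iff maps_cyl_def)
    moreover have "maps_cyl (g \<circ> f) (u @ s) v'"
      using uv uv' s by (auto simp: maps_cyl_def)
    ultimately show ?thesis by blast
  next
    assume "prefix u' v"
    then obtain s where s: "v = u' @ s" by (auto simp: prefix_def)
    have "maps_cyl (g \<circ> f) u (v' @ s)"
      using uv uv' s by (auto simp: maps_cyl_def)
    with uv show ?thesis by blast
  qed
qed

section \<open>Maps acting inside a single cylinder, and the basic rotation\<close>

primrec act :: "bool list \<Rightarrow> (cantor \<Rightarrow> cantor) \<Rightarrow> cantor \<Rightarrow> cantor" where
  "act [] f = f"
| "act (a # u) f = (\<lambda>\<omega>. if \<omega> 0 = a then a ## act u f (stl \<omega>) else \<omega>)"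

lemma act_Cons_scons [simp]: "act (a # u) f (b ## \<omega>) = (if a = b then b ## act u f \<omega> else b ## \<omega>)"
  by simp

declare act.simps(2) [simp del]

lemma act_wcat [simp]: "act u f (wcat u \<omega>) = wcat u (f \<omega>)"
  by (induction u) auto

lemma act_outside: "x \<notin> cylinder u \<Longrightarrow> act u f x = x"
proof (induction u arbitrary: x)
  case (Cons a u)
  then show ?case by (cases x rule: cantor_cases) auto
qed simp

lemma act_comp: "act u (f \<circ> g) = act u f \<circ> act u g"
proof (induction u)
  case (Cons a u)
  show ?case
  proof
    fix x show "act (a # u) (f \<circ> g) x = (act (a # u) f \<circ> act (a # u) g) x"
      by (cases x rule: cantor_cases) (auto simp: Cons)
  qed
qed simp

lemma act_id: "act u id = id"
proof (induction u)
  case (Cons a u)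
  show ?case
  proof
    fix x show "act (a # u) id x = id x"
      by (cases x rule: cantor_cases) (auto simp: Cons)
  qed
qed simp

lemma act_act: "act (u @ v) f = act u (act v f)"
proof (induction u)
  case (Cons a u)
  show ?case
  proof
    fix x show "act ((a # u) @ v) f x = act (a # u) (act v f) x"
      by (cases x rule: cantor_cases) (auto simp: Cons)
  qed
qed simp

lemma act_inv_comp:
  assumes "bij f"
  shows "act u (finv f) \<circ> act u f = id" "act u f \<circ> act u (finv f) = id"
  using assms surj_iff[of f] by (simp_all add: bij_is_inj bij_is_surj act_id flip: act_comp)

lemma bij_act: "bij f \<Longrightarrow> bij (act u f)"
  using act_inv_comp by (rule o_bij)

lemma order_auto_act: "order_auto f \<Longrightarrow> order_auto (act u f)"
  unfolding order_auto_def
proof (elim conjE, intro conjI)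
  assume m: "monotone less_fun less_fun f"
  show "monotone less_fun less_fun (act u f)"
  proof (induction u)
    case (Cons a u)
    show ?case
    proof (rule monotoneI)
      fix x y :: cantor
      assume "less_fun x y"
      then show "less_fun (act (a # u) f x) (act (a # u) f y)"
        using Cons by (cases x rule: cantor_cases; cases y rule: cantor_cases) (auto simp: monotone_def)
    qed
  qed (simp add: m)
qed (rule bij_act)

lemma pl_auto_act:
  assumes "pl_auto f"
  shows "pl_auto (act u f)"
  unfolding pl_auto_def
proof (intro conjI allI)
  show "order_auto (act u f)"
    using assms by (simp add: pl_auto_def order_auto_act)
  fix x
  show "\<exists>p q. x \<in> cylinder p \<and> maps_cyl (act u f) p q"
  proof (induction u arbitrary: x)
    case Nil
    then show ?case using assms by (auto simp: pl_auto_def)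
  next
    case (Cons a u)
    obtain b y where x: "x = b ## y" by (rule cantor_cases)
    show ?case
    proof (cases "a = b")
      case True
      obtain p q where "y \<in> cylinder p" "maps_cyl (act u f) p q"
        using Cons by blast
      then have "x \<in> cylinder (b # p)" "maps_cyl (act (a # u) f) (b # p) (b # q)"
        using True by (auto simp: x maps_cyl_def)
      then show ?thesis by blast
    next
      case False
      then have "x \<in> cylinder [b]" "maps_cyl (act (a # u) f) [b] [b]"
        by (auto simp: x maps_cyl_def)
      then show ?thesis by blast
    qed
  qed
qed

text \<open>A standard generator of F; on trees it takes ((a b) c) to (a (b c)). It moves points to
  the right, away from \<open>zeros\<close> and towards \<open>ones\<close>.\<close>

definition rot :: "cantor \<Rightarrow> cantor" where
  "rot \<omega> = (if \<omega> 0 then True ## \<omega> else if \<omega> 1 then True ## False ## stl (stl \<omega>) else stl \<omega>)"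

definition rot_inv :: "cantor \<Rightarrow> cantor" where
  "rot_inv \<omega> = (if \<not> \<omega> 0 then False ## \<omega> else if \<omega> 1 then stl \<omega> else False ## True ## stl (stl \<omega>))"

lemma rot_simps [simp]:
  "rot (True ## \<omega>) = True ## True ## \<omega>"
  "rot (False ## True ## \<omega>) = True ## False ## \<omega>"
  "rot (False ## False ## \<omega>) = False ## \<omega>"
  by (simp_all add: rot_def)

lemma rot_inv_simps [simp]:
  "rot_inv (False ## \<omega>) = False ## False ## \<omega>"
  "rot_inv (True ## False ## \<omega>) = False ## True ## \<omega>"
  "rot_inv (True ## True ## \<omega>) = True ## \<omega>"
  by (simp_all add: rot_inv_def)

lemma cantor_cases3:
  obtains x where "\<omega> = True ## x" | x where "\<omega> = False ## True ## x" | x where "\<omega> = False ## False ## x"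
proof -
  obtain a y where *: "\<omega> = a ## y" by (rule cantor_cases)
  obtain b x where "y = b ## x" by (rule cantor_cases)
  with * that show ?thesis by (cases a; cases b) auto
qed

lemma cantor_cases3':
  obtains x where "\<omega> = False ## x" | x where "\<omega> = True ## False ## x" | x where "\<omega> = True ## True ## x"
proof -
  obtain a y where *: "\<omega> = a ## y" by (rule cantor_cases)
  obtain b x where "y = b ## x" by (rule cantor_cases)
  with * that show ?thesis by (cases a; cases b) auto
qed

lemma rot_inv_rot [simp]: "rot_inv (rot x) = x"
  by (cases x rule: cantor_cases3) auto

lemma rot_rot_inv [simp]: "rot (rot_inv x) = x"
  by (cases x rule: cantor_cases3') auto

lemma bij_rot: "bij rot"
  by (rule o_bij[of rot_inv]) auto

lemma inv_rot: "finv rot = rot_inv"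
  by (rule inv_equality) auto

lemma pl_auto_rot: "pl_auto rot"
  unfolding pl_auto_def order_auto_def
proof (intro conjI allI)
  show "monotone less_fun less_fun rot"
  proof (rule monotoneI)
    fix x y :: cantor
    assume "less_fun x y"
    then show "less_fun (rot x) (rot y)"
      by (cases x rule: cantor_cases3; cases y rule: cantor_cases3) auto
  qed
  fix x
  have "maps_cyl rot [True] [True, True]" "maps_cyl rot [False, True] [True, False]"
    "maps_cyl rot [False, False] [False]"
    by (auto simp: maps_cyl_def)
  then show "\<exists>u v. x \<in> cylinder u \<and> maps_cyl rot u v"
    by (cases x rule: cantor_cases3) (metis cylinder_Nil UNIV_I scons_in_cylinder)+
qed (rule bij_rot)

section \<open>The transducer\<close>

text \<open>\<open>run\<close> adds letters at the end and starts in \<open>SL\<close>. Peeling off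
  the first letter, with an arbitrary initial state, gives equations for the action of each state on
  infinite words.\<close>

primrec runs :: "nat \<Rightarrow> state \<Rightarrow> cantor \<Rightarrow> bool list \<times> state" where
  "runs 0 s \<omega> = ([], s)"
| "runs (Suc n) s \<omega> =
     (let (w, s') = T_phi s (\<omega> 0); (w', s'') = runs n s' (stl \<omega>) in (w @ w', s''))"

lemma runs_Suc_snoc:
  "runs (Suc n) s \<omega> =
     (let (w, s') = runs n s \<omega>; (w', s'') = T_phi s' (\<omega> n) in (w @ w', s''))"
proof (induction n arbitrary: s \<omega>)
  case (Suc n)
  show ?case
    by (subst runs.simps(2), subst Suc) (simp add: Let_def split_beta stl_def)
qed (simp add: split_beta)

lemma run_eq_runs: "run \<omega> n = runs n SL \<omega>"
  by (induction n) (simp_all only: runs_Suc_snoc run.simps runs.simps(1))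

lemma runs_prefix: "m \<le> n \<Longrightarrow> prefix (fst (runs m s \<omega>)) (fst (runs n s \<omega>))"
proof (induction n rule: dec_induct)
  case (step n)
  have "prefix (fst (runs n s \<omega>)) (fst (runs (Suc n) s \<omega>))"
    by (simp only: runs_Suc_snoc) (simp add: split_beta Let_def)
  with step show ?case by (blast intro: prefix_order.trans)
qed simp

lemma length_runs: "k \<le> length (fst (runs (2 * k) s \<omega>))"
proof (induction k arbitrary: s \<omega>)
  case (Suc k)
  have "2 * Suc k = Suc (Suc (2 * k))" by simp
  with Suc[of "snd (T_phi (snd (T_phi s (\<omega> 0))) (\<omega> (Suc 0)))" "stl (stl \<omega>)"] show ?case
    by (cases s; cases "\<omega> 0"; cases "\<omega> (Suc 0)")
      (simp_all add: split_beta Let_def stl_def del: mult_Suc_right)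
qed simp

text \<open>Of two consecutive steps at least one emits a letter, so \<open>2 * Suc k\<close> steps
  suffice for the letter \<open>k\<close> from every state; this explicit bound replaces the
  \<open>LEAST\<close> in \<open>phi\<close>.\<close>

definition phis :: "state \<Rightarrow> cantor \<Rightarrow> cantor" where
  "phis s \<omega> = (\<lambda>k. fst (runs (2 * Suc k) s \<omega>) ! k)"

lemma phis_nth:
  assumes "k < length (fst (runs n s \<omega>))"
  shows "phis s \<omega> k = fst (runs n s \<omega>) ! k"
proof -
  have "k < length (fst (runs (2 * Suc k) s \<omega>))"
    using length_runs[of "Suc k" s \<omega>] by linarith
  moreover have "prefix (fst (runs (2 * Suc k) s \<omega>)) (fst (runs n s \<omega>)) \<or>
      prefix (fst (runs n s \<omega>)) (fst (runs (2 * Suc k) s \<omega>))"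
    using runs_prefix le_cases by meson
  ultimately show ?thesis
    using assms by (auto simp: phis_def prefix_def nth_append)
qed

lemma phi_eq_phis: "phi = phis SL"
proof (intro ext)
  fix \<omega> k
  have "k < length (fst (runs (2 * Suc k) SL \<omega>))"
    using length_runs[of "Suc k" SL \<omega>] by linarith
  then show "phi \<omega> k = phis SL \<omega> k"
    by (simp add: phis_def phi_nth[of k \<omega> "2 * Suc k"] run_eq_runs del: mult_Suc_right)
qed

lemma phis_step: "phis s (a ## \<omega>) = wcat (fst (T_phi s a)) (phis (snd (T_phi s a)) \<omega>)"
proof
  fix k
  define n where "n = 2 * Suc k"
  let ?w = "fst (T_phi s a)" and ?s = "snd (T_phi s a)"
  have len: "k < length (fst (runs n ?s \<omega>))"
    using length_runs[of "Suc k" ?s \<omega>] unfolding n_def by linarith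
  have runs: "fst (runs (Suc n) s (a ## \<omega>)) = ?w @ fst (runs n ?s \<omega>)"
    by (simp add: split_beta Let_def)
  have "phis s (a ## \<omega>) k = (?w @ fst (runs n ?s \<omega>)) ! k"
    using len runs by (subst phis_nth[of _ "Suc n"]) (simp_all del: runs.simps)
  also have "\<dots> = wcat ?w (phis ?s \<omega>) k"
    using len phis_nth[of "k - length ?w" n ?s \<omega>] by (simp add: wcat_def nth_append)
  finally show "phis s (a ## \<omega>) k = wcat ?w (phis ?s \<omega>) k" .
qed

lemma phis_simps [simp]:
  "phis SL (False ## \<omega>) = False ## phis SL \<omega>"
  "phis SL (True ## \<omega>) = True ## phis SR \<omega>"
  "phis SR (False ## \<omega>) = False ## phis SA \<omega>"
  "phis SR (True ## \<omega>) = True ## phis SR \<omega>"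
  "phis SA (False ## \<omega>) = False ## False ## phis SA \<omega>"
  "phis SA (True ## \<omega>) = phis SB \<omega>"
  "phis SB (False ## \<omega>) = False ## True ## phis SA \<omega>"
  "phis SB (True ## \<omega>) = True ## phis SR \<omega>"
  by (simp_all add: phis_step)

lemma phis_less: "less_fun x y \<Longrightarrow> less_fun (phis s x) (phis s y)"
proof -
  assume "less_fun x y"
  then obtain u x' y' where "x = wcat u (False ## x')" "y = wcat u (True ## y')"
    by (rule less_fun_split)
  moreover have "less_fun (phis s (wcat u (False ## x'))) (phis s (wcat u (True ## y')))"
  proof (induction u arbitrary: s)
    case Nil
    \<comment> \<open>In \<open>SA\<close> the letter 1 emits nothing, so one more letter is needed:
      the output then begins with 01 or 1, both above the 00 emitted on the letter 0.\<close>
    obtain b z where "y' = b ## z" by (rule cantor_cases)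
    then show ?case by (cases s; cases b) simp_all
  next
    case (Cons a u)
    then show ?case by (cases s; cases a) simp_all
  qed
  ultimately show ?thesis by simp
qed

text \<open>
  One step of the inverse transducer on the output \<open>y\<close> of state \<open>s\<close>: the input letter read off,
  the next state, and the rest of the output.
\<close>

fun inv_step :: "state \<Rightarrow> cantor \<Rightarrow> bool \<times> state \<times> cantor" where
  "inv_step SL y = (y 0, if y 0 then SR else SL, stl y)"
| "inv_step SR y = (y 0, if y 0 then SR else SA, stl y)"
| "inv_step SA y = (if \<not> y 0 \<and> \<not> y 1 then (False, SA, stl (stl y)) else (True, SB, y))"
| "inv_step SB y = (if y 0 then (True, SR, stl y) else (False, SA, stl (stl y)))"

primrec preimage_nth :: "nat \<Rightarrow> state \<Rightarrow> cantor \<Rightarrow> bool" where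
  "preimage_nth 0 s y = fst (inv_step s y)"
| "preimage_nth (Suc n) s y = (let (b, s', y') = inv_step s y in preimage_nth n s' y')"

definition preimage :: "state \<Rightarrow> cantor \<Rightarrow> cantor" where
  "preimage s y = (\<lambda>n. preimage_nth n s y)"

lemma preimage_step:
  "preimage s y = fst (inv_step s y) ## preimage (fst (snd (inv_step s y))) (snd (snd (inv_step s y)))"
  by (auto simp: fun_eq_iff preimage_def scons_def split_beta Let_def split: nat.split)

lemma preimage_simps [simp]:
  "preimage SL (a ## y) = a ## preimage (if a then SR else SL) y"
  "preimage SR (a ## y) = a ## preimage (if a then SR else SA) y"
  "preimage SA (False ## False ## y) = False ## preimage SA y"
  "preimage SA (False ## True ## y) = True ## preimage SB (False ## True ## y)"
  "preimage SA (True ## y) = True ## preimage SB (True ## y)"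
  "preimage SB (True ## y) = True ## preimage SR y"
  "preimage SB (False ## b ## y) = False ## preimage SA y"
  by (subst preimage_step; simp)+

text \<open>Outputs of \<open>SB\<close> begin with 01 or 1, hence the condition on
  \<open>y\<close>. The step from \<open>SA\<close> to \<open>SB\<close> leaves \<open>k\<close>
  unchanged, while every other step settles at least one letter; the summand 1 for \<open>SA\<close>
  makes the measure drop in both cases.\<close>

lemma phis_preimage_nth: "s = SB \<longrightarrow> y 0 \<or> y 1 \<Longrightarrow> phis s (preimage s y) k = y k"
proof (induction "2 * k + (if s = SA then 1 else 0)" arbitrary: k s y rule: less_induct)
  case less
  obtain a x where y: "y = a ## x" by (rule cantor_cases)
  obtain b z where x: "x = b ## z" by (rule cantor_cases)
  show ?case
  proof (cases k)
    case 0
    have "phis SB (preimage SB y) k = y k" if "s = SA" "a \<or> b"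
      using less.hyps[of k SB y] that by (simp add: y x)
    then show ?thesis
      using less.prems 0 by (cases s; cases a; cases b) (simp_all add: y x)
  next
    case (Suc m)
    have 1: "phis s' (preimage s' x) m = x m" if "s' = SL \<or> s' = SR \<or> s' = SA" for s'
      using less.hyps[of m s' x] that Suc by auto
    have 2: "phis SA (preimage SA z) n = z n" if "m = Suc n" for n
      using less.hyps[of n SA z] that Suc by auto
    have 3: "phis SB (preimage SB y) k = y k" if "s = SA" "a \<or> b"
      using less.hyps[of k SB y] that by (simp add: y x)
    show ?thesis
      using 1[of SL] 1[of SR] 1[of SA] 2 3 less.prems Suc
      by (cases s; cases a; cases b; cases m) (simp_all add: y x)
  qed
qed

text \<open>Strict monotonicity on a total order gives injectivity, and the inverse transducer gives
  surjectivity. From \<open>SB\<close> the latter fails: no output begins with 00.\<close>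

lemma order_auto_phis: "s \<noteq> SB \<Longrightarrow> order_auto (phis s)"
  unfolding order_auto_def
proof (intro conjI bijI injI)
  show "monotone less_fun less_fun (phis s)"
    by (rule monotoneI) (rule phis_less)
  fix x y
  assume "phis s x = phis s y"
  then show "x = y"
    using phis_less less_fun_total less_fun_irreflexive by metis
next
  assume "s \<noteq> SB"
  then have "phis s (preimage s y) = y" for y
    by (auto simp: fun_eq_iff phis_preimage_nth)
  then show "surj (phis s)" by (metis surjI)
qed

lemma order_auto_phi: "order_auto phi"
  by (simp add: phi_eq_phis order_auto_phis)

lemma surj_phis_funpow: "s \<noteq> SB \<Longrightarrow> \<exists>x. (phis s ^^ i) x = y"
  by (metis order_auto_funpow order_auto_inv_inv(2) order_auto_phis)

section \<open>Iterates of \<open>phi\<close> on runs of zeros and ones\<close>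

lemma phi_replicate_False: "phi (wcat (replicate n False) x) = wcat (replicate n False) (phi x)"
  by (induction n) (simp_all add: phi_eq_phis)

lemma phi_funpow_replicate_False [simp]:
  "(phi ^^ i) (wcat (replicate n False) x) = wcat (replicate n False) ((phi ^^ i) x)"
  by (induction i) (simp_all add: phi_replicate_False)

lemma phi_funpow_False [simp]: "(phi ^^ i) (False ## x) = False ## (phi ^^ i) x"
  using phi_funpow_replicate_False[of i 1 x] by simp

lemma phi_funpow_True [simp]: "(phi ^^ i) (True ## x) = True ## (phis SR ^^ i) x"
  by (induction i) (simp_all add: phi_eq_phis)

lemma phisR_funpow_True [simp]: "(phis SR ^^ i) (True ## x) = True ## (phis SR ^^ i) x"
  by (induction i) simp_all

lemma phisR_funpow_False [simp]: "(phis SR ^^ i) (False ## x) = False ## (phis SA ^^ i) x"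
  by (induction i) simp_all

lemma phisR_replicate_True [simp]:
  "phis SR (wcat (replicate n True) x) = wcat (replicate n True) (phis SR x)"
  by (induction n) simp_all

lemma phisR_funpow_replicate_True [simp]:
  "(phis SR ^^ i) (wcat (replicate n True) x) = wcat (replicate n True) ((phis SR ^^ i) x)"
  by (induction n) simp_all

lemma phisA_replicate_False:
  "phis SA (wcat (replicate n False) x) = wcat (replicate (2 * n) False) (phis SA x)"
  by (induction n) simp_all

lemma phisA_funpow_replicate_False:
  "(phis SA ^^ i) (wcat (replicate n False) x) = wcat (replicate (2 ^ i * n) False) ((phis SA ^^ i) x)"
  by (induction i) (simp_all add: phisA_replicate_False mult.assoc)

lemma phisA_funpow_False: "(phis SA ^^ i) (False ## x) = wcat (replicate (2 ^ i) False) ((phis SA ^^ i) x)"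
  using phisA_funpow_replicate_False[of i 1 x] by simp

text \<open>One pass from \<open>SA\<close> shortens 11 to 1 and enters \<open>SR\<close>, which
  copies the remaining ones. So each pass removes one 1, and \<open>i\<close> passes leave a single
  one.\<close>

lemma phisA_funpow_Trues:
  "(phis SA ^^ i) (wcat (replicate (Suc i) True) x) = True ## (phis SR ^^ i) x"
proof (induction i arbitrary: x)
  case (Suc i)
  have "(phis SA ^^ Suc i) (wcat (replicate (Suc (Suc i)) True) x) =
      (phis SA ^^ i) (wcat (replicate (Suc i) True) (phis SR x))"
    by (simp add: funpow_swap1)
  also have "\<dots> = True ## (phis SR ^^ Suc i) x"
    by (simp only: Suc) (simp add: funpow_swap1)
  finally show ?case .
qed simp

lemma phis_funpow_zeros [simp]: "(phis s ^^ i) zeros = zeros" if "s \<noteq> SB"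
  using that by (simp add: order_auto_funpow order_auto_phis order_auto_zeros)

lemma phi_funpow_zeros [simp]: "(phi ^^ i) zeros = zeros"
  by (simp add: phi_eq_phis)

section \<open>Output words, the states in which they end, and parity of runs of zeros\<close>

definition reaches :: "state \<Rightarrow> bool list \<Rightarrow> bool" where
  "reaches s v \<longleftrightarrow> (\<exists>p. \<forall>\<zeta>. phi (wcat p \<zeta>) = wcat v (phis s \<zeta>))"

lemma reachesI: "(\<And>\<zeta>. phi (wcat p \<zeta>) = wcat v (phis s \<zeta>)) \<Longrightarrow> reaches s v"
  unfolding reaches_def by blast

lemma reaches_append:
  assumes "reaches s v" "\<And>\<zeta>. phis s (wcat p \<zeta>) = wcat w (phis s' \<zeta>)"
  shows "reaches s' (v @ w)"
proof -
  obtain q where q: "\<And>\<zeta>. phi (wcat q \<zeta>) = wcat v (phis s \<zeta>)"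
    using assms(1) by (auto simp: reaches_def)
  show ?thesis
    by (rule reachesI[of "q @ p"]) (simp add: q assms(2))
qed

lemma reaches_SL: "reaches SL (replicate n False)"
  by (rule reachesI[of "replicate n False"]) (simp only: phi_replicate_False, simp add: phi_eq_phis)

lemma reaches_extend:
  "reaches SL v \<Longrightarrow> reaches SR (v @ [True])"
  "reaches SR v \<Longrightarrow> reaches SR (v @ [True])"
  "reaches SR v \<Longrightarrow> reaches SA (v @ [False])"
  "reaches SA v \<Longrightarrow> reaches SR (v @ [True])"
  "reaches SA v \<Longrightarrow> reaches SA (v @ [False, False])"
  "reaches SA v \<Longrightarrow> reaches SA (v @ [False, True])"
  by (erule reaches_append[of _ _ "[True]"], simp, erule reaches_append[of _ _ "[True]"], simp,
      erule reaches_append[of _ _ "[False]"], simp, erule reaches_append[of _ _ "[True, True]"], simp,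
      erule reaches_append[of _ _ "[False]"], simp, erule reaches_append[of _ _ "[True, False]"], simp)

text \<open>From \<open>SA\<close> the next output is 00, 01 or 1, and these words form a complete
  prefix code. So a word containing a 1 ends in \<open>SR\<close> or \<open>SA\<close> unless it
  stops halfway, namely after a word for \<open>SA\<close> and a single 0. \<open>SB\<close> is not
  listed because it is entered without output.\<close>

lemma reaches_cases:
  obtains n where "v = replicate n False"
  | "True \<in> set v" "reaches SR v"
  | "True \<in> set v" "reaches SA v"
  | v' where "True \<in> set v'" "v = v' @ [False]" "reaches SA v'"
proof -
  have "(\<exists>n. v = replicate n False) \<or> True \<in> set v \<and> (reaches SR v \<or> reaches SA v) \<or>
      (\<exists>v'. True \<in> set v' \<and> v = v' @ [False] \<and> reaches SA v')"
  proof (induction v rule: rev_induct)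
    case (snoc a v)
    then consider n where "v = replicate n False" | "True \<in> set v" "reaches SR v"
      | "True \<in> set v" "reaches SA v" | v' where "True \<in> set v'" "v = v' @ [False]" "reaches SA v'"
      by blast
    then show ?case
    proof cases
      case 1
      show ?thesis
      proof (cases a)
        case True
        then show ?thesis using 1 reaches_extend(1)[OF reaches_SL[of n]] by simp
      next
        case False
        then have "v @ [a] = replicate (Suc n) False"
          using 1 by (simp add: replicate_append_same)
        then show ?thesis by blast
      qed
    next
      case 2
      then show ?thesis
        using reaches_extend(2,3)[of v] by (cases a) auto
    next
      case 3
      then show ?thesis
        using reaches_extend(4)[of v] by (cases a) auto
    next
      case 4
      then show ?thesis
        using reaches_extend(5,6)[of v'] by (cases a) auto
    qed
  qed auto
  with that show ?thesis by blast
qed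

text \<open>If both words are emitted on the way to the same state, the remaining inputs are
  processed alike, and replacing the output prefix amounts to replacing the input prefix.\<close>

lemma reaches_sync:
  assumes f: "order_auto f" and fuv: "maps_cyl f u v"
    and u: "reaches s u" "phi x \<in> cylinder u" and v: "reaches s v" and s: "s \<noteq> SB"
  shows "\<exists>p q. x \<in> cylinder p \<and> maps_cyl (finv phi \<circ> f \<circ> phi) p q"
proof -
  obtain p where p: "\<And>\<zeta>. phi (wcat p \<zeta>) = wcat u (phis s \<zeta>)"
    using u(1) by (auto simp: reaches_def)
  obtain q where q: "\<And>\<zeta>. phi (wcat q \<zeta>) = wcat v (phis s \<zeta>)"
    using v by (auto simp: reaches_def)
  obtain y where "phi x = wcat u y"
    using u(2) by (rule cylinderE)
  moreover obtain \<zeta> where "phis s \<zeta> = y"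
    using surj_phis_funpow[OF s, of 1 y] by auto
  ultimately have "phi x = phi (wcat p \<zeta>)"
    by (simp add: p)
  then have "x = wcat p \<zeta>"
    by (metis order_auto_inv_inv(1) order_auto_phi)
  moreover have "maps_cyl (finv phi \<circ> f \<circ> phi) p q"
    using fuv by (simp add: maps_cyl_def p order_auto_phi flip: q)
  ultimately show ?thesis
    using wcat_in_cylinder_self by blast
qed

text \<open>
  If conjugating \<open>f\<close> back by \<open>phi\<close> leaves Thompson's group, then \<open>f\<close> shifts the parity of a run of
  zeros: it identifies a word reaching \<^const>\<open>SA\<close> with such a word followed by a single zero.
\<close>

lemma parity_shift:
  assumes f: "pl_auto f" and not: "\<not> pl_auto (finv phi \<circ> f \<circ> phi)"
  shows "\<exists>u v. True \<in> set u \<and> True \<in> set v \<and> reaches SA u \<and> reaches SA v \<and>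
    (maps_cyl f u (v @ [False]) \<or> maps_cyl f (v @ [False]) u)"
proof (rule ccontr)
  assume no: "\<not> ?thesis"
  have fo: "order_auto f" using f by (rule pl_auto_order_auto)
  have *: False if "maps_cyl f u (v @ [False])" "True \<in> set u" "True \<in> set v" "reaches SA u" "reaches SA v" for u v
    using no that by blast
  have **: False if "maps_cyl f (v @ [False]) u" "True \<in> set u" "True \<in> set v" "reaches SA u" "reaches SA v" for u v
    using no that by blast
  \<comment> \<open>A 0 takes \<open>SR\<close> to \<open>SA\<close>; appended to both words it
    produces the excluded pattern. \<open>AR\<close> is symmetric.\<close>
  have RA: False if "maps_cyl f u v" "True \<in> set u" "True \<in> set v" "reaches SR u" "reaches SA v" for u v
    using *[of "u @ [False]" v] that reaches_extend(3)[of u] maps_cyl_append[of f u v "[False]"] by simp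
  have AR: False if "maps_cyl f u v" "True \<in> set u" "True \<in> set v" "reaches SA u" "reaches SR v" for u v
    using **[of u "v @ [False]"] that reaches_extend(3)[of v] maps_cyl_append[of f u v "[False]"] by simp
  \<comment> \<open>A 1 keeps \<open>u\<close> in \<open>SR\<close> and completes the 01 after
    \<open>v\<close>, which reduces to \<open>RA\<close>.\<close>
  have RC: False if "maps_cyl f u (v @ [False])" "True \<in> set u" "True \<in> set v" "reaches SR u" "reaches SA v" for u v
    using RA[of "u @ [True]" "v @ [False, True]"] that reaches_extend(2)[of u] reaches_extend(6)[of v]
      maps_cyl_append[of f u "v @ [False]" "[True]"] by simp
  have "\<exists>p q. x \<in> cylinder p \<and> maps_cyl (finv phi \<circ> f \<circ> phi) p q" for x
  proof -
    obtain u0 v0 where uv0: "phi x \<in> cylinder u0" "maps_cyl f u0 v0"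
      using f by (rule pl_autoE)
    \<comment> \<open>A source word that stops halfway is lengthened by the next letter of
      \<open>phi x\<close>, which brings it to \<open>SA\<close>.\<close>
    have "\<exists>u v. phi x \<in> cylinder u \<and> maps_cyl f u v \<and>
        ((\<exists>n. u = replicate n False) \<or> True \<in> set u \<and> (reaches SR u \<or> reaches SA u))"
    proof (cases u0 rule: reaches_cases)
      case (4 u')
      obtain y where "phi x = wcat u0 y"
        using uv0(1) by (rule cylinderE)
      then have "phi x \<in> cylinder (u0 @ [y 0])"
        by (metis scons_collapse cylinder_iff wcat_Cons wcat_Nil wcat_append)
      moreover have "reaches SA (u0 @ [y 0])"
        using 4 reaches_extend(5,6)[of u'] by (cases "y 0") auto
      ultimately show ?thesis
        using maps_cyl_append[OF uv0(2), of "[y 0]"] 4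
        by (intro exI[of _ "u0 @ [y 0]"] exI[of _ "v0 @ [y 0]"]) auto
    qed (use uv0 in blast)+
    then obtain u v where uv: "phi x \<in> cylinder u" "maps_cyl f u v"
      and u: "(\<exists>n. u = replicate n False) \<or> True \<in> set u \<and> (reaches SR u \<or> reaches SA u)"
      by blast
    \<comment> \<open>Order automorphisms fix \<open>zeros\<close>, so \<open>u\<close> consists of
      zeros exactly if \<open>v\<close> does.\<close>
    have fz: "wcat u zeros = zeros \<longleftrightarrow> wcat v zeros = zeros"
      using maps_cylD[OF uv(2), of zeros] order_auto_zeros[OF fo]
        order_auto_finv_eq[OF fo, of zeros "wcat u zeros"] order_auto_inv_inv(1)[OF fo, of zeros]
      by auto
    from u show ?thesis
    proof
      assume "\<exists>n. u = replicate n False"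
      then have "reaches SL u" "reaches SL v"
        using fz reaches_SL by (auto simp: wcat_eq_zeros) (metis reaches_SL)
      then show ?thesis
        using reaches_sync[OF fo uv(2) _ uv(1)] by blast
    next
      assume u: "True \<in> set u \<and> (reaches SR u \<or> reaches SA u)"
      show ?thesis
      proof (cases v rule: reaches_cases)
        case (1 n)
        then have "wcat u zeros = zeros" using fz by simp
        then show ?thesis
          using u by (metis (full_types) in_set_replicate wcat_eq_zeros)
      next
        case 2
        then show ?thesis
          using u AR[OF uv(2)] reaches_sync[OF fo uv(2) _ uv(1)] by blast
      next
        case 3
        then show ?thesis
          using u RA[OF uv(2)] reaches_sync[OF fo uv(2) _ uv(1)] by blast
      next
        case (4 v')
        then show ?thesis
          using u RC[of u v'] *[of u v'] uv(2) by blast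
      qed
    qed
  qed
  moreover have "order_auto (finv phi \<circ> f \<circ> phi)"
    using fo order_auto_phi by (simp add: order_auto_comp order_auto_inv)
  ultimately show False
    using not by (simp add: pl_auto_def)
qed

lemma True_in_preimage:
  assumes "\<And>\<zeta>. phi (wcat p \<zeta>) = wcat v (phis SA \<zeta>)" "True \<in> set v"
  shows "True \<in> set p"
proof (rule ccontr)
  assume "True \<notin> set p"
  then have "p = replicate (length p) False"
    by (metis (full_types) replicate_eqI)
  then have "wcat p zeros = zeros" by (metis wcat_replicate_zeros)
  then have "wcat v zeros = zeros"
    using assms(1)[of zeros] phi_funpow_zeros[of 1] phis_funpow_zeros[of SA 1] by simp
  then show False
    using assms(2) by (metis (full_types) in_set_replicate wcat_eq_zeros)
qed

text \<open>At most one appended 0 brings \<open>v\<close> to \<open>SA\<close>. Its preimage under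
  \<open>phi\<close> again contains a 1, so the argument repeats one level below. Zeros added there
  are doubled on the way up, whence \<open>s + 2 * t\<close>.\<close>

lemma phi_funpow_SA:
  "True \<in> set v \<Longrightarrow>
    \<exists>q t. True \<in> set q \<and> (\<forall>\<zeta>. (phi ^^ j) (wcat q \<zeta>) = wcat (v @ replicate t False) ((phis SA ^^ j) \<zeta>))"
proof (induction j arbitrary: v)
  case 0
  then show ?case by (intro exI[of _ v] exI[of _ 0]) simp
next
  case (Suc j)
  have "\<exists>s. reaches SA (v @ replicate s False)"
  proof (cases v rule: reaches_cases)
    case 1
    then show ?thesis using Suc.prems by simp
  next
    case 2
    then show ?thesis
      using reaches_extend(3)[of v] by (intro exI[of _ 1]) simp
  next
    case 3
    then show ?thesis by (intro exI[of _ 0]) simp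
  next
    case (4 v')
    then show ?thesis
      using reaches_extend(5)[of v'] by (intro exI[of _ 1]) simp
  qed
  then obtain s p where p: "\<And>\<zeta>. phi (wcat p \<zeta>) = wcat (v @ replicate s False) (phis SA \<zeta>)"
    unfolding reaches_def by blast
  then have "True \<in> set p"
    using Suc.prems by (intro True_in_preimage[of p "v @ replicate s False"]) auto
  then obtain q t where q: "True \<in> set q"
    "\<And>\<zeta>. (phi ^^ j) (wcat q \<zeta>) = wcat (p @ replicate t False) ((phis SA ^^ j) \<zeta>)"
    using Suc.IH by blast
  have "(phi ^^ Suc j) (wcat q \<zeta>) = wcat (v @ replicate (s + 2 * t) False) ((phis SA ^^ Suc j) \<zeta>)" for \<zeta>
    by (simp add: q p phisA_replicate_False replicate_add)
  with q(1) show ?case by blast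
qed

text \<open>Since \<open>a\<close> itself reaches \<open>SA\<close>, the last pass needs no zero of
  its own and doubles those added before it; hence their number is even.\<close>

lemma reaches_SA_funpow:
  assumes "True \<in> set a" "reaches SA a"
  shows "\<exists>q t. True \<in> set q \<and> False \<in> set q \<and>
    (\<forall>\<zeta>. (phi ^^ Suc j) (wcat q \<zeta>) = wcat (a @ replicate (2 * t) False) ((phis SA ^^ Suc j) \<zeta>))"
proof -
  obtain p where p: "\<And>\<zeta>. phi (wcat p \<zeta>) = wcat a (phis SA \<zeta>)"
    using assms(2) by (auto simp: reaches_def)
  then have "True \<in> set p"
    using assms(1) by (auto intro: True_in_preimage)
  then obtain q t where q: "True \<in> set q"
    "\<And>\<zeta>. (phi ^^ j) (wcat q \<zeta>) = wcat (p @ replicate t False) ((phis SA ^^ j) \<zeta>)"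
    using phi_funpow_SA by blast
  \<comment> \<open>The extra 0 ensures that the input word contains both letters, as transitivity
    of F on words requires. It contributes \<open>2 ^ j\<close> zeros before the last pass.\<close>
  have "(phi ^^ Suc j) (wcat (q @ [False]) \<zeta>) =
      wcat (a @ replicate (2 * (t + 2 ^ j)) False) ((phis SA ^^ Suc j) \<zeta>)" for \<zeta>
    by (simp add: q p phisA_replicate_False phisA_funpow_False replicate_add algebra_simps)
  with q(1) show ?thesis
    by (intro exI[of _ "q @ [False]"] exI[of _ "t + 2 ^ j"]) auto
qed

section \<open>Prefix codes and binary trees\<close>

lemma lexordp_iff_less_fun:
  "\<not> prefix u v \<Longrightarrow> \<not> prefix v u \<Longrightarrow>
    ord_class.lexordp u v \<longleftrightarrow> less_fun (wcat u x) (wcat v y)"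
proof (induction u arbitrary: v)
  case (Cons a u)
  then show ?case by (cases v) auto
qed simp

lemma complete_prefix_code_iff:
  "complete_prefix_code U \<longleftrightarrow> finite U \<and> (\<forall>x. \<exists>!u. u \<in> U \<and> x \<in> cylinder u)"
proof
  assume U: "complete_prefix_code U"
  have "\<exists>!u. u \<in> U \<and> x \<in> cylinder u" for x
  proof -
    have "\<exists>u. u \<in> U \<and> x \<in> cylinder u"
      using U unfolding complete_prefix_code_def partition_on_def by blast
    moreover have "u = v" if "u \<in> U \<and> x \<in> cylinder u" "v \<in> U \<and> x \<in> cylinder v" for u v
    proof -
      have "prefix u v \<or> prefix v u"
        using that cylinder_comparable by blast
      moreover have "pairwise (\<lambda>u v. \<not> prefix u v) U"
        using U by (simp add: complete_prefix_code_def)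
      ultimately show ?thesis
        using that pairwiseD by (metis (no_types, lifting))
    qed
    ultimately show ?thesis by blast
  qed
  with U show "finite U \<and> (\<forall>x. \<exists>!u. u \<in> U \<and> x \<in> cylinder u)"
    by (simp add: complete_prefix_code_def)
next
  assume U: "finite U \<and> (\<forall>x. \<exists>!u. u \<in> U \<and> x \<in> cylinder u)"
  have eq: "u = v" if "u \<in> U" "v \<in> U" "x \<in> cylinder u" "x \<in> cylinder v" for u v x
    using U that by blast
  have "\<not> prefix u v" if "u \<in> U" "v \<in> U" "u \<noteq> v" for u v
    using eq[of u v "wcat v zeros"] that by (auto simp: prefix_def cylinder_iff)
  moreover have "partition_on UNIV (cylinder ` U)"
    unfolding partition_on_def
  proof (intro conjI)
    show "\<Union> (cylinder ` U) = UNIV" using U by blast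
    show "disjoint (cylinder ` U)"
      unfolding disjoint_def using eq by blast
    show "{} \<notin> cylinder ` U"
      using wcat_in_cylinder_self by fastforce
  qed
  ultimately show "complete_prefix_code U"
    using U by (simp add: complete_prefix_code_def pairwise_def)
qed

datatype tree = Leaf | Node tree tree

primrec leaves :: "tree \<Rightarrow> bool list list" where
  "leaves Leaf = [[]]"
| "leaves (Node l r) = map ((#) False) (leaves l) @ map ((#) True) (leaves r)"

lemma sorted_leaves: "sorted_wrt ord_class.lexordp (leaves t)"
  by (induction t) (auto simp: sorted_wrt_append sorted_wrt_map)

lemma complete_prefix_code_leaves: "complete_prefix_code (set (leaves t))"
  unfolding complete_prefix_code_iff
proof (intro conjI allI)
  fix x
  show "\<exists>!u. u \<in> set (leaves t) \<and> x \<in> cylinder u"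
  proof (induction t arbitrary: x)
    case Leaf
    show ?case by (intro ex1I[of _ "[]"]) simp_all
  next
    case (Node l r)
    obtain a y where x: "x = a ## y" by (rule cantor_cases)
    have "\<exists>!u. u \<in> set (leaves (if a then r else l)) \<and> y \<in> cylinder u"
      using Node[of y] by (cases a) simp_all
    then obtain u where u: "u \<in> set (leaves (if a then r else l))" "y \<in> cylinder u"
      "\<And>v. v \<in> set (leaves (if a then r else l)) \<Longrightarrow> y \<in> cylinder v \<Longrightarrow> v = u"
      by blast
    show ?case
    proof (rule ex1I[of _ "a # u"])
      show "a # u \<in> set (leaves (Node l r)) \<and> x \<in> cylinder (a # u)"
        using u(1,2) by (cases a) (simp_all add: x)
    next
      fix w assume w: "w \<in> set (leaves (Node l r)) \<and> x \<in> cylinder w"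
      then consider v where "w = False # v" "v \<in> set (leaves l)"
        | v where "w = True # v" "v \<in> set (leaves r)"
        by auto
      then show "w = a # u"
      proof cases
        case (1 v)
        then show ?thesis using w u(3)[of v] by (simp add: x)
      next
        case (2 v)
        then show ?thesis using w u(3)[of v] by (simp add: x)
      qed
    qed
  qed
qed simp

text \<open>Koenig's lemma. A word is bad if no finite tree below it has all leaves in
  \<open>P\<close>. A bad word has a bad child, so a bad root starts an infinite branch of bad
  words; but the point defined by this branch has a prefix in \<open>P\<close>, and there the
  one-leaf tree shows that the prefix is not bad.\<close>

lemma tree_of_local_property:
  assumes loc: "\<And>x. \<exists>u. x \<in> cylinder u \<and> P u" and app: "\<And>u v. P u \<Longrightarrow> P (u @ v)"
  shows "\<exists>t. \<forall>u \<in> set (leaves t). P u"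
proof (rule ccontr)
  define bad where "bad u \<longleftrightarrow> \<not> (\<exists>t. \<forall>v \<in> set (leaves t). P (u @ v))" for u
  assume "\<not> ?thesis"
  then have bad_Nil: "bad []" by (simp add: bad_def)
  have bad_step: "\<exists>a. bad (u @ [a])" if "bad u" for u
  proof (rule ccontr)
    assume "\<not> ?thesis"
    then obtain l r where "\<forall>v \<in> set (leaves l). P ((u @ [False]) @ v)" "\<forall>v \<in> set (leaves r). P ((u @ [True]) @ v)"
      unfolding bad_def by blast
    then have "\<forall>v \<in> set (leaves (Node l r)). P (u @ v)" by auto
    with that show False unfolding bad_def by blast
  qed
  define w where "w = rec_nat [] (\<lambda>_ u. u @ [SOME a. bad (u @ [a])])"
  have w_Suc: "w (Suc n) = w n @ [SOME a. bad (w n @ [a])]" for n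
    by (simp add: w_def)
  have bad_w: "bad (w n)" for n
  proof (induction n)
    case (Suc n)
    then show ?case
      using someI_ex[OF bad_step] by (simp add: w_Suc)
  qed (simp add: w_def bad_Nil)
  have len: "length (w n) = n" for n
    by (induction n) (simp_all add: w_Suc, simp add: w_def)
  define x where "x n = w (Suc n) ! n" for n
  have in_w: "x \<in> cylinder (w n)" for n
  proof (induction n)
    case (Suc n)
    then obtain y where y: "x = wcat (w n) y" by (rule cylinderE)
    then have "y 0 = x n" by (simp add: wcat_def len)
    then have "w (Suc n) = w n @ [y 0]"
      by (simp add: x_def w_Suc len nth_append)
    then show ?case
      using y scons_collapse[of y] by (metis cylinder_iff wcat_Cons wcat_Nil wcat_append)
  qed (simp add: w_def)
  obtain u where u: "x \<in> cylinder u" "P u" using loc by blast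
  have "u = w (length u)"
    using u(1) in_w len by (metis cylinder_length_unique)
  with u(2) bad_w[of "length u"] show False
    unfolding bad_def by (metis append_Nil2 empty_iff empty_set leaves.simps(1) set_ConsD)
qed

lemma open_cylinder: "open (cylinder u)"
proof -
  have "cylinder u = (\<Inter>i<length u. (\<lambda>x. x i) -` {u ! i})"
  proof (rule Set.set_eqI)
    fix x
    have "x \<in> cylinder u \<longleftrightarrow> (\<forall>i<length u. x i = u ! i)"
    proof (induction u arbitrary: x)
      case (Cons a u)
      then show ?case
        by (cases x rule: cantor_cases) (auto simp: less_Suc_eq_0_disj)
    qed simp
    then show "x \<in> cylinder u \<longleftrightarrow> x \<in> (\<Inter>i<length u. (\<lambda>x. x i) -` {u ! i})"
      by auto
  qed
  moreover have "open ((\<lambda>x::cantor. x i) -` {b})" for i b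
    by (rule open_vimage) (auto simp: open_discrete)
  ultimately show ?thesis
    by (simp add: open_INT)
qed

lemma continuous_pl_auto:
  assumes "pl_auto f"
  shows "continuous_on UNIV f"
proof (rule continuous_on_coordinatewise_then_product)
  fix i
  have "open ((\<lambda>x. f x i) -` B)" for B :: "bool set"
  proof (subst open_subopen, intro ballI)
    fix x assume x: "x \<in> (\<lambda>x. f x i) -` B"
    obtain u v where uv: "x \<in> cylinder u" "maps_cyl f u v"
      using assms by (rule pl_autoE)
    then obtain y where y: "x = wcat u y" by (auto elim: cylinderE)
    obtain w where w: "length w = Suc i" "y \<in> cylinder w"
      using in_cylinder_of_length by blast
    have *: "f z i = (v @ w) ! i" if z: "z \<in> cylinder (u @ w)" for z
    proof -
      obtain z' where "z = wcat (u @ w) z'" using z by (rule cylinderE)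
      then have "f z = wcat (v @ w) z'"
        using uv(2) by (simp add: maps_cyl_def)
      then show ?thesis
        using w(1) by (simp only: wcat_nth_less[of i "v @ w"] length_append)
    qed
    have "x \<in> cylinder (u @ w)" using w y by simp
    then show "\<exists>T. open T \<and> x \<in> T \<and> T \<subseteq> (\<lambda>x. f x i) -` B"
      using x * open_cylinder by (intro exI[of _ "cylinder (u @ w)"]) auto
  qed
  then show "continuous_on UNIV (\<lambda>x. f x i)"
    by (simp add: continuous_on_open_vimage)
qed

text \<open>Compactness gives a tree whose leaves serve as source words. Bijectivity makes the image
  words a complete prefix code, and monotonicity puts them in the right order.\<close>

lemma pl_auto_imp_thompson_F:
  assumes f: "pl_auto f"
  shows "f \<in> thompson_F"
proof -
  have fo: "order_auto f" using f by (rule pl_auto_order_auto)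
  have "\<exists>u. x \<in> cylinder u \<and> (\<exists>v. maps_cyl f u v)" for x
    using pl_autoE[OF f, of x] by blast
  then obtain t where t: "\<forall>u \<in> set (leaves t). \<exists>v. maps_cyl f u v"
    using tree_of_local_property[of "\<lambda>u. \<exists>v. maps_cyl f u v"] maps_cyl_append by blast
  then obtain g where g: "\<And>u. u \<in> set (leaves t) \<Longrightarrow> maps_cyl f u (g u)"
    by metis
  have unique: "\<exists>!u. u \<in> set (leaves t) \<and> x \<in> cylinder u" for x
    using complete_prefix_code_leaves[of t] by (simp add: complete_prefix_code_iff)
  have gcyl: "x \<in> cylinder (g u) \<longleftrightarrow> finv f x \<in> cylinder u" if "u \<in> set (leaves t)" for u x
  proof -
    have "finv f x = wcat u \<omega> \<longleftrightarrow> x = wcat (g u) \<omega>" for \<omega>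
      using g[OF that] by (simp add: order_auto_finv_eq fo maps_cyl_def)
    then show ?thesis by (auto simp: cylinder_iff)
  qed
  have "complete_prefix_code (set (map g (leaves t)))"
    unfolding complete_prefix_code_iff
  proof (intro conjI allI)
    fix x
    obtain u where u: "u \<in> set (leaves t)" "finv f x \<in> cylinder u"
      using unique[of "finv f x"] by blast
    show "\<exists>!v. v \<in> set (map g (leaves t)) \<and> x \<in> cylinder v"
    proof (rule ex1I[of _ "g u"])
      fix v assume "v \<in> set (map g (leaves t)) \<and> x \<in> cylinder v"
      then show "v = g u"
        using gcyl u unique[of "finv f x"] by auto
    qed (use u gcyl in auto)
  qed simp
  moreover have "sorted_wrt ord_class.lexordp (map g (leaves t))"
    unfolding sorted_wrt_map
  proof (rule sorted_wrt_mono_rel[OF _ sorted_leaves])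
    fix u v
    assume uv: "u \<in> set (leaves t)" "v \<in> set (leaves t)" "ord_class.lexordp u v"
    then have "u \<noteq> v" by (auto simp: lexordp_irreflexive')
    then have disj: "\<not> (x \<in> cylinder u \<and> x \<in> cylinder v)" for x
      using unique[of x] uv by blast
    have pf: "\<not> prefix u v" "\<not> prefix v u"
      using disj[of "wcat v zeros"] disj[of "wcat u zeros"] by (auto simp: prefix_def cylinder_iff)
    have "\<not> (x \<in> cylinder (g u) \<and> x \<in> cylinder (g v))" for x
      using disj gcyl uv by blast
    from this[of "wcat (g v) zeros"] this[of "wcat (g u) zeros"]
    have "\<not> prefix (g u) (g v)" "\<not> prefix (g v) (g u)"
      by (auto simp: prefix_def cylinder_iff)
    moreover have "less_fun (wcat u zeros) (wcat v zeros)"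
      using uv pf lexordp_iff_less_fun by blast
    then have "less_fun (wcat (g u) zeros) (wcat (g v) zeros)"
      using order_auto_less[OF fo, of "wcat u zeros" "wcat v zeros"]
        maps_cylD[OF g[OF uv(1)], of zeros] maps_cylD[OF g[OF uv(2)], of zeros] by simp
    ultimately show "ord_class.lexordp (g u) (g v)"
      using lexordp_iff_less_fun by blast
  qed
  moreover have "\<forall>i<length (leaves t). \<forall>\<omega>. f (wcat (leaves t ! i) \<omega>) = wcat (map g (leaves t) ! i) \<omega>"
    using g by (simp add: maps_cyl_def)
  moreover have "homeomorphic_map euclidean euclidean f"
  proof (rule homeomorphic_maps_imp_map)
    show "homeomorphic_maps euclidean euclidean f (finv f)"
      using f fo pl_auto_inv[OF f] by (simp add: homeomorphic_maps_def continuous_pl_auto)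
  qed
  ultimately show ?thesis
    using fo complete_prefix_code_leaves sorted_leaves
    unfolding thompson_F_def order_auto_def mem_Collect_eq
    by (intro conjI exI[of _ "leaves t"] exI[of _ "map g (leaves t)"]) auto
qed

lemma thompson_F_imp_pl_auto:
  assumes "f \<in> thompson_F"
  shows "pl_auto f"
proof -
  obtain us vs where f: "homeomorphic_map euclidean euclidean f" "monotone less_fun less_fun f"
    and us: "complete_prefix_code (set us)"
      "\<And>i \<omega>. i < length us \<Longrightarrow> f (wcat (us ! i) \<omega>) = wcat (vs ! i) \<omega>"
    using assms unfolding thompson_F_def by blast
  have "bij f"
    using homeomorphic_imp_injective_map[OF f(1)] homeomorphic_imp_surjective_map[OF f(1)]
    by (simp add: bij_def)
  moreover have "\<exists>u v. x \<in> cylinder u \<and> maps_cyl f u v" for x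
  proof -
    have "\<exists>!u. u \<in> set us \<and> x \<in> cylinder u"
      using us(1) by (simp add: complete_prefix_code_iff)
    then obtain u where u: "u \<in> set us" "x \<in> cylinder u" by blast
    then obtain i where "i < length us" "us ! i = u"
      by (auto simp: in_set_conv_nth)
    then have "maps_cyl f u (vs ! i)"
      using us(2) by (auto simp: maps_cyl_def)
    with u(2) show ?thesis by blast
  qed
  ultimately show ?thesis
    using f(2) by (simp add: pl_auto_def order_auto_def)
qed

lemma complete_prefix_code_Cons:
  assumes U: "complete_prefix_code U" and "[] \<notin> U"
  shows "complete_prefix_code {u. a # u \<in> U}"
  unfolding complete_prefix_code_iff
proof (intro conjI allI)
  show "finite {u. a # u \<in> U}"
    using finite_vimageI[of U "(#) a"] U by (simp add: vimage_def complete_prefix_code_def)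
  fix x
  have "\<exists>!w. w \<in> U \<and> a ## x \<in> cylinder w"
    using U by (simp add: complete_prefix_code_iff)
  then obtain w where w: "w \<in> U" "a ## x \<in> cylinder w"
    "\<And>v. v \<in> U \<Longrightarrow> a ## x \<in> cylinder v \<Longrightarrow> v = w"
    by blast
  obtain b u where wu: "w = b # u"
    using assms(2) w(1) by (cases w) auto
  show "\<exists>!u. u \<in> {u. a # u \<in> U} \<and> x \<in> cylinder u"
  proof (rule ex1I[of _ u])
    show "u \<in> {u. a # u \<in> U} \<and> x \<in> cylinder u"
      using w(1,2) wu by simp
    fix v assume "v \<in> {u. a # u \<in> U} \<and> x \<in> cylinder v"
    then show "v = u"
      using w(3)[of "a # v"] wu by simp
  qed
qed

text \<open>Induction on a bound for the word lengths: unless the code consists of the empty word,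
  splitting by the first letter yields two codes with shorter words, the subtrees.\<close>

lemma complete_prefix_code_tree:
  "complete_prefix_code U \<Longrightarrow> \<exists>t. set (leaves t) = U"
proof -
  have "\<exists>t. set (leaves t) = U" if "complete_prefix_code U" "\<forall>u\<in>U. length u \<le> n" for n
    using that
  proof (induction n arbitrary: U)
    case 0
    then have "U \<subseteq> {[]}" by auto
    moreover have "U \<noteq> {}"
      using 0(1) by (auto simp: complete_prefix_code_iff)
    ultimately have "U = {[]}" by blast
    then show ?case by (intro exI[of _ Leaf]) simp
  next
    case (Suc n)
    show ?case
    proof (cases "[] \<in> U")
      case True
      have "u = []" if "u \<in> U" for u
        using Suc.prems(1) True that unfolding complete_prefix_code_def pairwise_def
        by (metis Nil_prefix)
      then have "U = {[]}" using True by blast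
      then show ?thesis by (intro exI[of _ Leaf]) simp
    next
      case False
      have "\<exists>t. set (leaves t) = {u. a # u \<in> U}" for a
      proof (rule Suc.IH[OF complete_prefix_code_Cons[OF Suc.prems(1) False]])
        show "\<forall>u \<in> {u. a # u \<in> U}. length u \<le> n"
          using Suc.prems(2) by fastforce
      qed
      then obtain l r where "set (leaves l) = {u. False # u \<in> U}" "set (leaves r) = {u. True # u \<in> U}"
        by metis
      then have "b # u \<in> set (leaves (Node l r)) \<longleftrightarrow> b # u \<in> U" for b u
        by (cases b) auto
      moreover have "[] \<notin> set (leaves (Node l r))" by auto
      ultimately have "u \<in> set (leaves (Node l r)) \<longleftrightarrow> u \<in> U" for u
        using False by (cases u) blast+
      then show ?thesis by blast
    qed
  qed
  moreover assume "complete_prefix_code U"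
  moreover from this have "finite U" by (simp add: complete_prefix_code_def)
  then have "\<forall>u\<in>U. length u \<le> Max (length ` U)" by simp
  ultimately show ?thesis by blast
qed

lemma thompson_F_trees:
  assumes "pl_auto f"
  obtains t t' where "list_all2 (maps_cyl f) (leaves t) (leaves t')"
proof -
  obtain us vs where us: "complete_prefix_code (set us)" "sorted_wrt ord_class.lexordp us"
    and vs: "complete_prefix_code (set vs)" "sorted_wrt ord_class.lexordp vs"
    and len: "length us = length vs"
    and f: "\<And>i \<omega>. i < length us \<Longrightarrow> f (wcat (us ! i) \<omega>) = wcat (vs ! i) \<omega>"
    using pl_auto_imp_thompson_F[OF assms] unfolding thompson_F_def by blast
  obtain t t' where "set (leaves t) = set us" "set (leaves t') = set vs"
    using us(1) vs(1) complete_prefix_code_tree by metis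
  \<comment> \<open>A strictly sorted list is determined by its set.\<close>
  then have "leaves t = us" "leaves t' = vs"
    using us(2) vs(2) sorted_leaves linorder.strict_sorted_equal[OF lexordp_linorder] by metis+
  then have "list_all2 (maps_cyl f) (leaves t) (leaves t')"
    using len f by (simp add: list_all2_conv_all_nth maps_cyl_def)
  then show ?thesis by (rule that)
qed

section \<open>Rotations generate\<close>

text \<open>The right comb with \<open>n + 1\<close> leaves is the normal form: rotations move every
  tree to the comb with equally many leaves.\<close>

primrec comb :: "nat \<Rightarrow> tree" where
  "comb 0 = Leaf"
| "comb (Suc n) = Node Leaf (comb n)"

lemma length_leaves_pos: "length (leaves t) > 0"
  by (induction t) auto

definition bij_group :: "('a \<Rightarrow> 'a) set \<Rightarrow> bool" where
  "bij_group G \<longleftrightarrow> id \<in> G \<and> (\<forall>f\<in>G. bij f \<and> finv f \<in> G) \<and> (\<forall>f\<in>G. \<forall>g\<in>G. f \<circ> g \<in> G)"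

text \<open>Fixing the complement of the cylinder is what allows a move of one subtree to be read as
  a move of the whole tree, in \<open>tree_move_left\<close> and
  \<open>tree_move_right\<close>.\<close>

definition tree_move ::
    "(cantor \<Rightarrow> cantor) set \<Rightarrow> bool list \<Rightarrow> tree \<Rightarrow> tree \<Rightarrow> bool" where
  "tree_move G u t t' \<longleftrightarrow> (\<exists>g\<in>G. (\<forall>x. x \<notin> cylinder u \<longrightarrow> g x = x) \<and>
     list_all2 (\<lambda>v w. maps_cyl g (u @ v) (u @ w)) (leaves t) (leaves t'))"

lemma tree_move_trans:
  assumes "bij_group G" "tree_move G u t1 t2" "tree_move G u t2 t3"
  shows "tree_move G u t1 t3"
proof -
  obtain g where g: "g \<in> G" "\<forall>x. x \<notin> cylinder u \<longrightarrow> g x = x"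
    "list_all2 (\<lambda>v w. maps_cyl g (u @ v) (u @ w)) (leaves t1) (leaves t2)"
    using assms(2) by (auto simp: tree_move_def)
  obtain h where h: "h \<in> G" "\<forall>x. x \<notin> cylinder u \<longrightarrow> h x = x"
    "list_all2 (\<lambda>v w. maps_cyl h (u @ v) (u @ w)) (leaves t2) (leaves t3)"
    using assms(3) by (auto simp: tree_move_def)
  have "list_all2 (\<lambda>v w. maps_cyl (h \<circ> g) (u @ v) (u @ w)) (leaves t1) (leaves t3)"
    by (rule list_all2_trans[OF _ g(3) h(3)]) (rule maps_cyl_comp)
  with g h assms(1) show ?thesis
    unfolding tree_move_def bij_group_def by (intro bexI[of _ "h \<circ> g"]) auto
qed

lemma tree_move_refl: "bij_group G \<Longrightarrow> tree_move G u t t"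
  unfolding tree_move_def bij_group_def
  by (intro bexI[of _ id]) (auto simp: maps_cyl_id list_all2_same)

lemma tree_move_left:
  assumes "tree_move G (u @ [False]) l l'"
  shows "tree_move G u (Node l r) (Node l' r)"
proof -
  obtain g where g: "g \<in> G" "\<And>x. x \<notin> cylinder (u @ [False]) \<Longrightarrow> g x = x"
    "list_all2 (\<lambda>v w. maps_cyl g (u @ [False] @ v) (u @ [False] @ w)) (leaves l) (leaves l')"
    using assms by (auto simp: tree_move_def)
  have "maps_cyl g (u @ True # v) (u @ True # v)" for v
    by (auto simp: maps_cyl_def intro!: g(2))
  moreover have "g x = x" if "x \<notin> cylinder u" for x
    using that cylinder_append_subset[of u "[False]"] g(2) by blast
  ultimately show ?thesis
    unfolding tree_move_def using g(1,3)
    by (intro bexI[of _ g]) (auto intro!: list_all2_appendI simp: list_all2_map1 list_all2_map2 list_all2_same)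
qed

lemma tree_move_right:
  assumes "tree_move G (u @ [True]) r r'"
  shows "tree_move G u (Node l r) (Node l r')"
proof -
  obtain g where g: "g \<in> G" "\<And>x. x \<notin> cylinder (u @ [True]) \<Longrightarrow> g x = x"
    "list_all2 (\<lambda>v w. maps_cyl g (u @ [True] @ v) (u @ [True] @ w)) (leaves r) (leaves r')"
    using assms by (auto simp: tree_move_def)
  have "maps_cyl g (u @ False # v) (u @ False # v)" for v
    by (auto simp: maps_cyl_def intro!: g(2))
  moreover have "g x = x" if "x \<notin> cylinder u" for x
    using that cylinder_append_subset[of u "[True]"] g(2) by blast
  ultimately show ?thesis
    unfolding tree_move_def using g(1,3)
    by (intro bexI[of _ g]) (auto intro!: list_all2_appendI simp: list_all2_map1 list_all2_map2 list_all2_same)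
qed

lemma tree_move_rot:
  assumes "act u rot \<in> G"
  shows "tree_move G u (Node (Node a b) c) (Node a (Node b c))"
  unfolding tree_move_def using assms
  by (intro bexI[of _ "act u rot"])
    (auto intro!: list_all2_appendI simp: act_outside list_all2_map1 list_all2_map2 list_all2_same maps_cyl_def)

text \<open>One rotation at the root puts the first leaf of the left comb on the spine; what remains
  is the same problem in the right subtree.\<close>

lemma tree_move_join:
  assumes G: "bij_group G" and "\<And>w. act (u @ w) rot \<in> G"
  shows "tree_move G u (Node (comb a) (comb b)) (comb (Suc (a + b)))"
  using assms(2)
proof (induction a arbitrary: u)
  case 0
  show ?case by (simp add: tree_move_refl G)
next
  case (Suc a)
  have "tree_move G u (Node (comb (Suc a)) (comb b)) (Node Leaf (Node (comb a) (comb b)))"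
    using tree_move_rot[of u G Leaf "comb a" "comb b"] Suc.prems[of "[]"] by simp
  moreover have "tree_move G (u @ [True]) (Node (comb a) (comb b)) (comb (Suc (a + b)))"
    using Suc.IH[of "u @ [True]"] Suc.prems by simp
  then have "tree_move G u (Node Leaf (Node (comb a) (comb b))) (comb (Suc (Suc a + b)))"
    using tree_move_right by simp
  ultimately show ?case using tree_move_trans[OF G] by blast
qed

lemma tree_move_comb:
  assumes G: "bij_group G" and "\<And>w. act (u @ w) rot \<in> G"
  shows "tree_move G u t (comb (length (leaves t) - 1))"
  using assms(2)
proof (induction t arbitrary: u)
  case Leaf
  show ?case by (simp add: tree_move_refl G)
next
  case (Node l r)
  let ?l = "comb (length (leaves l) - 1)" and ?r = "comb (length (leaves r) - 1)"
  have "tree_move G (u @ [False]) l ?l" "tree_move G (u @ [True]) r ?r"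
    using Node.IH(1)[of "u @ [False]"] Node.IH(2)[of "u @ [True]"] Node.prems by simp_all
  then have "tree_move G u (Node l r) (Node ?l ?r)"
    using tree_move_trans[OF G] tree_move_left tree_move_right by blast
  moreover have "length (leaves (Node l r)) - 1 = Suc ((length (leaves l) - 1) + (length (leaves r) - 1))"
    using length_leaves_pos[of l] length_leaves_pos[of r]
    unfolding leaves.simps length_append length_map by arith
  ultimately show ?case
    using tree_move_join[OF G Node.prems] tree_move_trans[OF G] by metis
qed

text \<open>The two trees of \<open>f\<close> have equally many leaves, so \<open>g\<close> and
  \<open>h\<close> in \<open>G\<close> move both to the same comb, and \<open>act u f\<close> is the
  inverse of \<open>h\<close> after \<open>g\<close>.\<close>

lemma rot_generates:
  assumes G: "bij_group G" and rot: "\<And>w. act (u @ w) rot \<in> G" and f: "pl_auto f"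
  shows "act u f \<in> G"
proof -
  obtain t t' where t: "list_all2 (maps_cyl f) (leaves t) (leaves t')"
    using f by (rule thompson_F_trees)
  then have len: "length (leaves t) = length (leaves t')" by (rule list_all2_lengthD)
  define c where "c = comb (length (leaves t) - 1)"
  obtain g where g: "g \<in> G" "\<forall>x. x \<notin> cylinder u \<longrightarrow> g x = x"
    "list_all2 (\<lambda>v w. maps_cyl g (u @ v) (u @ w)) (leaves t) (leaves c)"
    using tree_move_comb[OF G rot, of t] unfolding tree_move_def c_def by blast
  obtain h where h: "h \<in> G" "\<forall>x. x \<notin> cylinder u \<longrightarrow> h x = x"
    "list_all2 (\<lambda>v w. maps_cyl h (u @ v) (u @ w)) (leaves t') (leaves c)"
    using tree_move_comb[OF G rot, of t'] len unfolding tree_move_def c_def by auto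
  have "h (act u f x) = g x" for x
  proof (cases "x \<in> cylinder u")
    case True
    then obtain y where y: "x = wcat u y" by (rule cylinderE)
    have "\<exists>!v. v \<in> set (leaves t) \<and> y \<in> cylinder v"
      using complete_prefix_code_leaves[of t] by (simp add: complete_prefix_code_iff)
    then obtain v where "v \<in> set (leaves t)" "y \<in> cylinder v" by blast
    then obtain i z where i: "i < length (leaves t)" and z: "y = wcat (leaves t ! i) z"
      by (auto simp: in_set_conv_nth cylinder_iff)
    have "f (wcat (leaves t ! i) z) = wcat (leaves t' ! i) z"
      "g (wcat u (wcat (leaves t ! i) z)) = wcat u (wcat (leaves c ! i) z)"
      "h (wcat u (wcat (leaves t' ! i) z)) = wcat u (wcat (leaves c ! i) z)"
      using t g(3) h(3) i len by (auto simp: list_all2_conv_all_nth maps_cyl_def)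
    then show ?thesis by (simp add: y z)
  next
    case False
    then show ?thesis using g(2) h(2) by (simp add: act_outside)
  qed
  moreover have "inj h" using h(1) G by (simp add: bij_group_def bij_is_inj)
  ultimately have "finv h (g x) = act u f x" for x
    by (metis inv_f_f)
  then have "act u f = finv h \<circ> g" by auto
  then show ?thesis
    using g(1) h(1) G by (simp add: bij_group_def)
qed

section \<open>Behaviour near the end points, conjugation, and transitivity on cylinders\<close>

lemma pl_auto_long_cylinders:
  assumes "pl_auto f"
  obtains u v where "L \<le> length u" "L \<le> length v" "x \<in> cylinder u" "f x \<in> cylinder v" "maps_cyl f u v"
proof -
  obtain u v where uv: "x \<in> cylinder u" "maps_cyl f u v"
    using assms by (rule pl_autoE)
  obtain y where y: "x = wcat u y" using uv(1) by (rule cylinderE)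
  obtain w where w: "length w = L" "y \<in> cylinder w"
    using in_cylinder_of_length by blast
  show ?thesis
    using that[of "u @ w" "v @ w"] uv(2) w y by (simp add: maps_cyl_append maps_cylD)
qed

lemma pl_auto_at_zeros:
  assumes "pl_auto f"
  obtains a b where "L \<le> a" "L \<le> b" "maps_cyl f (replicate a False) (replicate b False)"
proof -
  obtain u v where uv: "L \<le> length u" "L \<le> length v" "zeros \<in> cylinder u" "f zeros \<in> cylinder v" "maps_cyl f u v"
    using assms by (rule pl_auto_long_cylinders)
  have "u = replicate (length u) False" "v = replicate (length v) False"
    using uv(3,4) order_auto_zeros[OF pl_auto_order_auto[OF assms]] zeros_in_cylinder by auto
  with uv that show ?thesis by metis
qed

lemma pl_auto_at_ones:
  assumes "pl_auto f"
  obtains a b where "L \<le> a" "L \<le> b" "maps_cyl f (replicate a True) (replicate b True)"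
proof -
  obtain u v where uv: "L \<le> length u" "L \<le> length v" "ones \<in> cylinder u" "f ones \<in> cylinder v" "maps_cyl f u v"
    using assms by (rule pl_auto_long_cylinders)
  have "u = replicate (length u) True" "v = replicate (length v) True"
    using uv(3,4) order_auto_ones[OF pl_auto_order_auto[OF assms]] ones_in_cylinder by auto
  with uv that show ?thesis by metis
qed

lemma cylinder_replicate_mono: "m \<le> n \<Longrightarrow> cylinder (replicate n a) \<subseteq> cylinder (replicate m a)"
  using cylinder_append_subset[of "replicate m a" "replicate (n - m) a"]
  by (simp flip: replicate_add)

lemma not_in_cylinder_replicate:
  "x \<notin> cylinder (replicate n a) \<Longrightarrow> \<exists>j<n. x \<in> cylinder (replicate j a @ [\<not> a])"
proof (induction n arbitrary: x)
  case (Suc n)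
  obtain b y where x: "x = b ## y" by (rule cantor_cases)
  show ?case
  proof (cases "b = a")
    case True
    with Suc.prems have "y \<notin> cylinder (replicate n a)" by (simp add: x)
    then obtain j where "j < n" "y \<in> cylinder (replicate j a @ [\<not> a])"
      using Suc.IH by blast
    then show ?thesis
      using True by (intro exI[of _ "Suc j"]) (simp add: x)
  next
    case False
    then show ?thesis by (intro exI[of _ 0]) (auto simp: x)
  qed
qed simp

lemma maps_cyl_in_iff:
  assumes f: "order_auto f" and "maps_cyl f u v"
  shows "f x \<in> cylinder v \<longleftrightarrow> x \<in> cylinder u"
proof -
  have "f x = wcat v \<omega> \<longleftrightarrow> x = wcat u \<omega>" for \<omega>
    using order_auto_finv_eq[OF f, of "f x" "wcat u \<omega>"] f maps_cylD[OF assms(2), of \<omega>] by auto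
  then show ?thesis by (simp add: cylinder_iff)
qed

lemma act_in_cylinder_iff: "order_auto f \<Longrightarrow> act u f x \<in> cylinder u \<longleftrightarrow> x \<in> cylinder u"
  by (metis act_outside act_wcat cylinderE wcat_in_cylinder_self)

text \<open>Conjugation sees \<open>k\<close> only on the support of \<open>act u f\<close>. Hence
  any element of \<open>K\<close> replacing \<open>u\<close> by \<open>v\<close> transports the maps
  acting inside \<open>u\<close> to those acting inside \<open>v\<close>.\<close>

lemma conj_act:
  assumes k: "order_auto k" and "maps_cyl k u v"
  shows "k \<circ> act u f \<circ> finv k = act v f"
proof
  fix x
  show "(k \<circ> act u f \<circ> finv k) x = act v f x"
  proof (cases "x \<in> cylinder v")
    case True
    then obtain y where x: "x = wcat v y" by (rule cylinderE)
    then have "finv k x = wcat u y"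
      using k by (simp add: order_auto_finv_eq maps_cylD[OF assms(2)])
    then show ?thesis by (simp add: x maps_cylD[OF assms(2)])
  next
    case False
    then have "finv k x \<notin> cylinder u"
      using maps_cyl_in_iff[OF assms, of "finv k x"] k by simp
    with False show ?thesis using k by (simp add: act_outside)
  qed
qed

text \<open>Both sides take the left comb with four leaves to the right comb, along the two ways
  round the pentagon of the five binary trees with four leaves.\<close>

lemma rot_pentagon: "rot \<circ> rot = act [True] rot \<circ> rot \<circ> act [False] rot"
proof
  fix x
  obtain a y where x: "x = a ## y" by (rule cantor_cases)
  show "(rot \<circ> rot) x = (act [True] rot \<circ> rot \<circ> act [False] rot) x"
    by (cases a; cases y rule: cantor_cases3) (simp_all add: x)
qed

lemma pl_auto_rot_inv: "pl_auto rot_inv"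
  using pl_auto_inv[OF pl_auto_rot] by (simp add: inv_rot)

text \<open>Rotations shorten every word of more than two letters that contains both: 00w and 11w
  lose a letter at once, and words starting with 01 or 10 absorb their third letter, possibly
  exchanging 01 and 10.\<close>

lemma pl_auto_move_to_01:
  assumes "True \<in> set p" "False \<in> set p"
  shows "\<exists>f. pl_auto f \<and> maps_cyl f p [False, True]"
  using assms
proof (induction p rule: length_induct)
  case (1 p)
  have step: ?case
    if f: "pl_auto f" "maps_cyl f p q" and q: "length q < length p" "True \<in> set q" "False \<in> set q" for f q
  proof -
    obtain g where "pl_auto g" "maps_cyl g q [False, True]"
      using 1(1) q by auto
    with f show ?thesis
      using pl_auto_comp[of f g] maps_cyl_comp[of f p q g] by blast
  qed
  note pl = pl_auto_rot pl_auto_rot_inv pl_auto_act pl_auto_comp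
  have 01: ?case if "p = False # True # w" for w
  proof (cases w)
    case Nil
    then show ?thesis using that pl_auto_id maps_cyl_id by blast
  next
    case (Cons a w')
    then show ?thesis
      using that step[of "act [False] rot_inv" "False # True # w'"]
        step[of "act [True] rot \<circ> rot" "True # False # w'"]
      by (cases a) (auto simp: maps_cyl_def pl)
  qed
  have 10: ?case if "p = True # False # w" for w
  proof (cases w)
    case Nil
    then show ?thesis
      using that pl_auto_rot_inv by (intro exI[of _ rot_inv]) (simp add: maps_cyl_def)
  next
    case (Cons a w')
    then show ?thesis
      using that step[of "act [True] rot" "True # False # w'"]
        step[of "act [False] rot_inv \<circ> rot_inv" "False # True # w'"]
      by (cases a) (auto simp: maps_cyl_def pl)
  qed
  obtain a q where "p = a # q" using 1(2) by (cases p) auto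
  moreover obtain b w where "q = b # w" using 1(2,3) calculation by (cases q; cases a) auto
  ultimately have p: "p = a # b # w" by simp
  show ?case
    using 01[of w] 10[of w] 1(2,3) step[of rot "False # w"] step[of rot_inv "True # w"]
    by (cases a; cases b) (auto simp: p maps_cyl_def pl)
qed

lemma pl_auto_transitive:
  assumes "True \<in> set p" "False \<in> set p" "True \<in> set q" "False \<in> set q"
  shows "\<exists>f. pl_auto f \<and> maps_cyl f p q"
proof -
  obtain f g where "pl_auto f" "maps_cyl f p [False, True]" "pl_auto g" "maps_cyl g q [False, True]"
    using assms pl_auto_move_to_01 by metis
  then show ?thesis
    using pl_auto_comp[of f "finv g"] pl_auto_inv[of g] maps_cyl_comp[of f p _ "finv g" q]
      maps_cyl_inv[of g q] order_auto_bij[OF pl_auto_order_auto, of g] by blast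
qed

lemma pl_auto_restrict:
  assumes f: "pl_auto f" and id: "\<And>x. x \<notin> cylinder u \<Longrightarrow> f x = x"
  obtains g where "pl_auto g" "f = act u g"
proof -
  have fo: "order_auto f" using f by (rule pl_auto_order_auto)
  have cyl: "f x \<in> cylinder u \<longleftrightarrow> x \<in> cylinder u" for x
  proof (cases "f x \<in> cylinder u")
    case False
    then have "f (f x) = f x" by (rule id)
    then have "f x = x"
      by (metis fo order_auto_inv_inv(1))
    then show ?thesis by simp
  next
    case True
    then show ?thesis using id[of x] by (cases "x \<in> cylinder u") auto
  qed
  have "\<exists>\<eta>. f (wcat u \<omega>) = wcat u \<eta>" for \<omega>
    using cyl[of "wcat u \<omega>"] by (simp add: cylinder_iff)
  then obtain g where g: "\<And>\<omega>. f (wcat u \<omega>) = wcat u (g \<omega>)" by metis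
  have fact: "f = act u g"
  proof
    fix x show "f x = act u g x"
      using id[of x] g by (cases "x \<in> cylinder u") (auto simp: cylinder_iff act_outside)
  qed
  have less: "less_fun (g x) (g y) \<longleftrightarrow> less_fun x y" for x y
    using order_auto_less[OF fo, of "wcat u x" "wcat u y"] by (simp add: g)
  have "inj g"
  proof (rule injI)
    fix x y assume "g x = g y"
    then show "x = y"
      using less[of x y] less[of y x] less_fun_total[of x y] by auto
  qed
  moreover have "surj g"
    unfolding surj_def
  proof
    fix y
    have "finv f (wcat u y) \<in> cylinder u"
      using cyl[of "finv f (wcat u y)"] fo by simp
    then obtain x where "finv f (wcat u y) = wcat u x" by (rule cylinderE)
    then have "wcat u y = wcat u (g x)"
      using fo by (simp add: order_auto_finv_eq g)
    then show "\<exists>x. y = g x" by auto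
  qed
  ultimately have "order_auto g"
    using less by (simp add: order_auto_def bij_def monotone_def)
  moreover have "\<exists>p q. x \<in> cylinder p \<and> maps_cyl g p q" for x
  proof -
    obtain p q where pq: "length u \<le> length p" "length u \<le> length q"
      "wcat u x \<in> cylinder p" "f (wcat u x) \<in> cylinder q" "maps_cyl f p q"
      using f by (rule pl_auto_long_cylinders)
    \<comment> \<open>Cylinder words at least as long as \<open>u\<close> extend it, so
      \<open>u\<close> can be cancelled from the replacement.\<close>
    have "prefix u p" "prefix u q"
      using pq cylinder_comparable[of _ u p] cylinder_comparable[of _ u q] g[of x]
      by (metis wcat_in_cylinder_self prefix_length_prefix prefix_order.refl)+
    then obtain p' q' where "p = u @ p'" "q = u @ q'" by (auto simp: prefix_def)
    then have "x \<in> cylinder p'" "maps_cyl g p' q'"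
      using pq by (simp_all add: maps_cyl_def g)
    then show ?thesis by blast
  qed
  ultimately have "pl_auto g" by (simp add: pl_auto_def)
  with fact that show ?thesis by blast
qed

text \<open>
  The differences between related numbers form, up to sign, a subgroup of the integers; it contains
  an odd number and a power of two.
\<close>

lemma additive_equivalence_0_1:
  fixes N :: "nat \<Rightarrow> nat \<Rightarrow> bool"
  assumes sym: "\<And>x y. N x y \<Longrightarrow> N y x" and trans: "\<And>x y z. N x y \<Longrightarrow> N y z \<Longrightarrow> N x z"
    and add: "\<And>x y z. N x y \<Longrightarrow> N (x + z) (y + z)" and refl: "\<And>x. N x x"
    and pow: "N 0 (2 ^ i)" and odd: "N a b" "even a" "odd b"
  shows "N 0 1"
proof -
  define P where "P d \<longleftrightarrow> (\<exists>c. N c (c + d))" for d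
  have P_diff: "P (m - n)" if P: "P m" "P n" "n \<le> m" for m n
  proof -
    obtain c d where "N c (c + m)" "N d (d + n)" using P by (auto simp: P_def)
    then have "N (c + d) (c + d + m)" "N (c + d) (c + d + n)"
      using add[of c "c + m" d] add[of d "d + n" c] by (simp_all add: ac_simps)
    then have "N (c + d + n) (c + d + n + (m - n))"
      using sym trans P(3) by (metis add.assoc le_add_diff_inverse)
    then show ?thesis unfolding P_def by blast
  qed
  have P_gcd: "P (gcd m n)" if "P m" "P n" for m n
    using that
  proof (induction "m + n" arbitrary: m n rule: less_induct)
    case less
    consider "m = 0" | "n = 0" | "m \<noteq> 0" "n \<noteq> 0" "m \<le> n" | "m \<noteq> 0" "n \<noteq> 0" "n \<le> m"
      by linarith
    then show ?case
    proof cases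
      case 3
      then have "P (gcd m (n - m))"
        using less P_diff by simp
      then show ?thesis
        using gcd_diff1_nat[OF 3(3)] by (simp add: gcd.commute)
    next
      case 4
      then have "P (gcd (m - n) n)"
        using less P_diff by simp
      then show ?thesis
        using gcd_diff1_nat[OF 4(3)] by simp
    qed (use less in simp_all)
  qed
  have "\<exists>d. odd d \<and> P d"
  proof (cases "a \<le> b")
    case True
    then show ?thesis
      using odd by (intro exI[of _ "b - a"]) (auto simp: P_def intro!: exI[of _ a])
  next
    case False
    then show ?thesis
      using odd sym by (intro exI[of _ "a - b"]) (auto simp: P_def intro!: exI[of _ b])
  qed
  then obtain d where d: "odd d" "P d" by blast
  have "P (2 ^ i)" using pow unfolding P_def by (intro exI[of _ 0]) simp
  then have "P (gcd d (2 ^ i))" using P_gcd d(2) by blast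
  moreover have "coprime d (2 ^ i)" using d(1) by simp
  ultimately obtain c where c: "N c (c + 1)" by (auto simp: P_def)
  have mult: "N 0 (2 ^ i * n)" for n
  proof (induction n)
    case (Suc n)
    have "N (2 ^ i * n) (2 ^ i * Suc n)" using add[OF pow, of "2 ^ i * n"] by simp
    with Suc show ?case using trans by blast
  qed (simp add: refl)
  \<comment> \<open>The pair \<open>c\<close>, \<open>c + 1\<close> is translated so as to start at
    a multiple of \<open>2 ^ i\<close>, which is related to 0.\<close>
  have "c \<le> 2 ^ i * c" by simp
  then have "N (2 ^ i * c) (2 ^ i * c + 1)"
    using add[OF c, of "2 ^ i * c - c"] by simp
  moreover have "N 1 (2 ^ i * c + 1)" using add[OF mult[of c], of 1] by simp
  ultimately show ?thesis using mult sym trans by blast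
qed

section \<open>Overgroups\<close>

text \<open>The two inclusions \<open>H_group i\<close> in \<open>K\<close> in F, stated through the
  local description of F.\<close>

locale overgroup =
  fixes i :: nat and K :: "(cantor \<Rightarrow> cantor) set"
  assumes K: "bij_group K" and K_pl_auto: "\<And>f. f \<in> K \<Longrightarrow> pl_auto f"
    and conj_in_K: "\<And>f. pl_auto f \<Longrightarrow> (phi ^^ i) \<circ> f \<circ> finv (phi ^^ i) \<in> K"
begin

lemma K_order: "k \<in> K \<Longrightarrow> order_auto k"
  by (simp add: K_pl_auto pl_auto_order_auto)

lemma K_id: "id \<in> K" and K_comp: "f \<in> K \<Longrightarrow> g \<in> K \<Longrightarrow> f \<circ> g \<in> K" and K_inv: "f \<in> K \<Longrightarrow> finv f \<in> K"
  using K by (auto simp: bij_group_def)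

lemma K_funpow: "f \<in> K \<Longrightarrow> f ^^ n \<in> K"
  by (induction n) (auto simp: K_id K_comp)

definition lift :: "(cantor \<Rightarrow> cantor) \<Rightarrow> cantor \<Rightarrow> cantor" where
  "lift f = (phi ^^ i) \<circ> f \<circ> finv (phi ^^ i)"

lemma lift_in_K: "pl_auto f \<Longrightarrow> lift f \<in> K"
  unfolding lift_def by (rule conj_in_K)

lemma order_auto_phi_funpow: "order_auto (phi ^^ n)"
  by (simp add: order_auto_funpow order_auto_phi)

lemma lift_phi: "lift f ((phi ^^ i) x) = (phi ^^ i) (f x)"
  by (simp add: lift_def order_auto_phi_funpow)

lemma phi_preimage: obtains y where "x = (phi ^^ i) y"
  by (metis order_auto_inv_inv(2) order_auto_phi_funpow)

text \<open>If \<open>u\<close> and \<open>v\<close> come from inputs \<open>p\<close> and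
  \<open>q\<close> with the same action \<theta> on the tails, a replacement of \<open>p\<close> by
  \<open>q\<close> lifts to one of \<open>u\<close> by \<open>v\<close>. Here \<theta> will be an
  iterate of \<open>phis SR\<close>, \<open>phis SA\<close> or \<open>phi\<close>.\<close>

lemma maps_cyl_lift:
  assumes "\<And>\<zeta>. (phi ^^ i) (wcat p \<zeta>) = wcat u (\<theta> \<zeta>)" "\<And>\<zeta>. (phi ^^ i) (wcat q \<zeta>) = wcat v (\<theta> \<zeta>)"
    and "surj \<theta>" "maps_cyl f p q"
  shows "maps_cyl (lift f) u v"
  unfolding maps_cyl_def
proof
  fix \<omega>
  obtain \<zeta> where "\<omega> = \<theta> \<zeta>" using assms(3) by (rule surjE)
  then show "lift f (wcat u \<omega>) = wcat v \<omega>"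
    by (metis assms(1,2,4) lift_phi maps_cyl_def)
qed

lemma surj_R: "surj (phis SR ^^ i)" and surj_A: "surj (phis SA ^^ i)" and surj_phi: "surj (phi ^^ i)"
  using surj_phis_funpow[of SR i] surj_phis_funpow[of SA i] surj_phis_funpow[of SL i]
  by (simp_all add: phi_eq_phis) (metis surjI)+

definition sim :: "bool list \<Rightarrow> bool list \<Rightarrow> bool" where
  "sim u v \<longleftrightarrow> (\<exists>k\<in>K. maps_cyl k u v)"

lemma sim_refl: "sim u u"
  using K_id maps_cyl_id by (auto simp: sim_def)

lemma sim_sym: "sim u v \<Longrightarrow> sim v u"
  unfolding sim_def using K_inv K_order order_auto_bij maps_cyl_inv by blast

lemma sim_trans [trans]: "sim u v \<Longrightarrow> sim v w \<Longrightarrow> sim u w"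
  unfolding sim_def using K_comp maps_cyl_comp by blast

lemma sim_append: "sim u v \<Longrightarrow> sim (u @ w) (v @ w)"
  unfolding sim_def using maps_cyl_append by blast

lemma sim_of_state:
  assumes "\<And>\<zeta>. (phi ^^ i) (wcat p \<zeta>) = wcat u (\<theta> \<zeta>)" "\<And>\<zeta>. (phi ^^ i) (wcat q \<zeta>) = wcat v (\<theta> \<zeta>)"
    and "surj \<theta>" "True \<in> set p" "False \<in> set p" "True \<in> set q" "False \<in> set q"
  shows "sim u v"
proof -
  obtain f where "pl_auto f" "maps_cyl f p q"
    using pl_auto_transitive assms by blast
  then show ?thesis
    unfolding sim_def using lift_in_K maps_cyl_lift[OF assms(1-3)] by blast
qed

lemma sim_01_011: "sim [False, True] [False, True, True]"
  by (rule sim_of_state[of "[False, True]" _ "phis SR ^^ i" "[False, True, True]"]) (simp_all add: surj_R)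

lemma sim_01_0101: "sim [False, True] [False, True, False, True]"
\<comment> \<open>After 010 the \<open>i + 1\<close> ones shrink to a single 1 and lead to
  \<open>SR\<close>.\<close>
proof (rule sim_of_state[of "[False, True]" _ "phis SR ^^ i" "[False, True, False] @ replicate (Suc i) True"])
  fix \<zeta>
  show "(phi ^^ i) (wcat ([False, True, False] @ replicate (Suc i) True) \<zeta>) =
      wcat [False, True, False, True] ((phis SR ^^ i) \<zeta>)"
    using phisA_funpow_Trues[of i \<zeta>] by simp
qed (simp_all add: surj_R)

lemma sim_010_pow: "sim [False, True, False] ([False, True, False] @ replicate (2 ^ i) False)"
  by (rule sim_of_state[of "[False, True, False]" _ "phis SA ^^ i" "[False, True, False, False]"])
    (simp_all add: surj_A phisA_funpow_False)

text \<open>\<open>parity_shift\<close> identifies \<open>u\<close> with \<open>v\<close> followed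
  by 0, where both reach \<open>SA\<close>. As the level is positive, \<open>u\<close> and
  \<open>v\<close> become equivalent to 010 after an even number of zeros. So 010 followed by an
  even number of zeros is equivalent to 010 followed by an odd number, and with the period
  \<open>2 ^ i\<close> this gives a shift by one.\<close>

lemma sim_010_0100:
  assumes "i = Suc j" and f: "f \<in> K" "\<not> pl_auto (finv phi \<circ> f \<circ> phi)"
  shows "sim [False, True, False] [False, True, False, False]"
proof -
  obtain u v where u: "True \<in> set u" "reaches SA u" and v: "True \<in> set v" "reaches SA v"
    and "maps_cyl f u (v @ [False]) \<or> maps_cyl f (v @ [False]) u"
    using parity_shift[OF K_pl_auto[OF f(1)] f(2)] by blast
  then have uv: "sim u (v @ [False])"
    using f(1) sim_sym by (auto simp: sim_def)
  have even: "\<exists>t. sim [False, True, False] (w @ replicate (2 * t) False)"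
    if w: "True \<in> set w" "reaches SA w" for w
  proof -
    obtain q t where q: "True \<in> set q" "False \<in> set q"
      "\<And>\<zeta>. (phi ^^ Suc j) (wcat q \<zeta>) = wcat (w @ replicate (2 * t) False) ((phis SA ^^ Suc j) \<zeta>)"
      using reaches_SA_funpow[OF w, of j] by blast
    have "sim [False, True, False] (w @ replicate (2 * t) False)"
    proof (rule sim_of_state)
      show "(phi ^^ i) (wcat [False, True, False] \<zeta>) = wcat [False, True, False] ((phis SA ^^ i) \<zeta>)" for \<zeta>
        by simp
      show "(phi ^^ i) (wcat q \<zeta>) = wcat (w @ replicate (2 * t) False) ((phis SA ^^ i) \<zeta>)" for \<zeta>
        using q(3) unfolding assms(1) .
    qed (use q in \<open>simp_all add: surj_A\<close>)
    then show ?thesis by blast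
  qed
  obtain t where t: "sim [False, True, False] (u @ replicate (2 * t) False)"
    using even[OF u] by blast
  obtain t' where t': "sim [False, True, False] (v @ replicate (2 * t') False)"
    using even[OF v] by blast
  define N where "N x y \<longleftrightarrow> sim ([False, True, False] @ replicate x False) ([False, True, False] @ replicate y False)" for x y
  have "N 0 1"
  proof (rule additive_equivalence_0_1)
    show "N x y \<Longrightarrow> N y x" for x y unfolding N_def by (rule sim_sym)
    show "N x y \<Longrightarrow> N y z \<Longrightarrow> N x z" for x y z unfolding N_def by (rule sim_trans)
    show "N x x" for x unfolding N_def by (rule sim_refl)
    show "N x y \<Longrightarrow> N (x + z) (y + z)" for x y z
      unfolding N_def using sim_append[of "[False, True, False] @ replicate x False" "[False, True, False] @ replicate y False" "replicate z False"]
      by (simp add: replicate_add)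
    show "N 0 (2 ^ i)" using sim_010_pow by (simp add: N_def)
    show "N (2 * t') (Suc (2 * t))"
    proof -
      have "sim ([False, True, False] @ replicate (2 * t') False) (u @ replicate (2 * t + 2 * t') False)"
        using sim_append[OF t, of "replicate (2 * t') False"] by (simp add: replicate_add)
      also have "sim (u @ replicate (2 * t + 2 * t') False) (v @ replicate (Suc (2 * t + 2 * t')) False)"
        using sim_append[OF uv, of "replicate (2 * t + 2 * t') False"] by simp
      also have "v @ replicate (Suc (2 * t + 2 * t')) False = v @ replicate (2 * t' + Suc (2 * t)) False"
        by (simp add: add.commute)
      also have "sim (v @ replicate (2 * t' + Suc (2 * t)) False)
          ([False, True, False] @ replicate (Suc (2 * t)) False)"
        using sim_append[OF sim_sym[OF t'], of "replicate (Suc (2 * t)) False"]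
        by (simp only: replicate_add append_assoc)
      finally show ?thesis
        unfolding N_def .
    qed
  qed simp_all
  then show ?thesis by (simp add: N_def)
qed

section \<open>Gluing elements of the overgroup along a cut\<close>

lemma shift_words:
  assumes S: "S \<in> K" and w: "\<And>n. maps_cyl S (w n) (w (Suc n))" and A: "\<And>x. x \<in> A \<Longrightarrow> S x = x"
  shows "\<exists>g\<in>K. maps_cyl g (w a) (w b) \<and> (\<forall>x\<in>A. g x = x)"
proof -
  have pow: "maps_cyl (S ^^ n) (w a) (w (a + n))" for n a
  proof (induction n)
    case (Suc n)
    then show ?case
      using maps_cyl_comp[OF Suc w] by (simp only: funpow.simps add_Suc_right)
  qed (simp add: maps_cyl_def)
  have fixed: "(S ^^ n) x = x" if "x \<in> A" for n x
    using that by (induction n) (simp_all add: A)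
  have o: "order_auto (S ^^ n)" for n
    using S by (simp add: K_funpow K_order)
  show ?thesis
  proof (cases "a \<le> b")
    case True
    then show ?thesis
      using pow[of "b - a" a] fixed S by (intro bexI[of _ "S ^^ (b - a)"]) (simp_all add: K_funpow)
  next
    case False
    have "maps_cyl (finv (S ^^ (a - b))) (w a) (w b)"
      using maps_cyl_inv[OF order_auto_bij[OF o] pow[of "a - b" b]] False by simp
    moreover have "finv (S ^^ (a - b)) x = x" if "x \<in> A" for x
      using fixed[OF that] o by (simp add: order_auto_finv_eq)
    ultimately show ?thesis
      using S by (intro bexI[of _ "finv (S ^^ (a - b))"]) (simp_all add: K_funpow K_inv)
  qed
qed

text \<open>An element of \<open>H_group i\<close> supported in the cylinder of 0. It drives all
  points there except \<open>zeros\<close> towards \<open>False ## ones\<close>: leading zeros are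
  removed until one is left, then ones are inserted after 01.\<close>

definition push :: "cantor \<Rightarrow> cantor" where
  "push = lift (act [False] rot)"

lemma push_in_K: "push \<in> K"
  by (simp add: push_def lift_in_K pl_auto_act pl_auto_rot)

lemma push_outside: "x \<in> cylinder [True] \<Longrightarrow> push x = x"
proof -
  assume "x \<in> cylinder [True]"
  then obtain y where "x = True ## y" by (auto simp: cylinder_iff)
  moreover obtain z where "y = (phis SR ^^ i) z"
    using surj_R by (rule surjE)
  ultimately have "x = (phi ^^ i) (True ## z)" by simp
  then show ?thesis
    unfolding push_def by (simp only: lift_phi act_Cons_scons) simp
qed

lemma push_01: "maps_cyl push ([False, True] @ replicate n True) ([False, True] @ replicate (Suc n) True)"
  unfolding push_def
  by (rule maps_cyl_lift[of "[False, True] @ replicate n True" _ "phis SR ^^ i" "[False, True] @ replicate (Suc n) True"])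
    (simp_all add: surj_R maps_cyl_def)

lemma push_funpow_01: "maps_cyl (push ^^ n) [False, True] ([False, True] @ replicate n True)"
proof (induction n)
  case (Suc n)
  show ?case using maps_cyl_comp[OF Suc push_01] by (simp only: funpow.simps)
qed (simp add: maps_cyl_def)

lemma push_step:
  assumes "x \<in> cylinder (replicate (Suc (Suc j)) False @ [True])"
  shows "push x \<in> cylinder (replicate (Suc j) False @ [True])"
proof -
  obtain y where "x = wcat (replicate (Suc (Suc j)) False @ [True]) y"
    using assms by (rule cylinderE)
  moreover obtain z where "y = (phis SR ^^ i) z"
    using surj_R by (rule surjE)
  ultimately have "x = (phi ^^ i) (wcat (replicate (Suc (Suc j)) False @ [True]) z)" by simp
  then have "push x = (phi ^^ i) (act [False] rot (wcat (replicate (Suc (Suc j)) False @ [True]) z))"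
    by (simp only: push_def lift_phi)
  then show ?thesis
    by (cases j) simp_all
qed

lemma push_funpow:
  "x \<in> cylinder (replicate (Suc j) False @ [True]) \<Longrightarrow>
    (push ^^ (j + n)) x \<in> cylinder ([False, True] @ replicate n True)"
proof (induction j arbitrary: x)
  case 0
  then obtain y where "x = wcat [False, True] y" by (auto elim: cylinderE)
  then have "(push ^^ n) x = wcat ([False, True] @ replicate n True) y"
    using maps_cylD[OF push_funpow_01] by simp
  then show ?case by (simp only: add_0 wcat_in_cylinder_self)
next
  case (Suc j)
  then have "(push ^^ (j + n)) (push x) \<in> cylinder ([False, True] @ replicate n True)"
    using push_step by blast
  then show ?case by (simp add: funpow_swap1)
qed

lemma push_funpow_into:
  assumes "x \<in> cylinder [False]" "x \<notin> cylinder (replicate N False)"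
  shows "(push ^^ (N + M)) x \<in> cylinder ([False, True] @ replicate M True)"
proof -
  obtain j where j: "j < N" "x \<in> cylinder (replicate j False @ [True])"
    using not_in_cylinder_replicate[OF assms(2)] by auto
  then obtain m where m: "j = Suc m"
    using assms(1) by (cases j) (auto simp: cylinder_iff)
  have "(push ^^ (m + (N - m + M))) x \<in> cylinder ([False, True] @ replicate (N - m + M) True)"
    using j(2) m by (intro push_funpow) simp
  moreover have "m + (N - m + M) = N + M" using j(1) m by simp
  moreover have "[False, True] @ replicate (N - m + M) True =
      ([False, True] @ replicate M True) @ replicate (N - m) True"
    by (simp add: add.commute flip: replicate_add)
  ultimately show ?thesis
    using cylinder_append_subset by (metis subsetD)
qed

abbreviation mid :: cantor where "mid \<equiv> True ## zeros"

lemma less_mid: "less_fun x mid \<longleftrightarrow> x \<in> cylinder [False]"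
  by (cases x rule: cantor_cases) (auto simp: zeros_least)

lemma not_less_mid: "\<not> less_fun x mid \<longleftrightarrow> x \<in> cylinder [True]"
  by (cases x rule: cantor_cases) (auto simp: zeros_least)

text \<open>The discrepancy \<open>j\<close> fixes the cut, so just left of it \<open>j\<close>
  changes only the number of ones after 01, and a power \<open>g\<close> of \<open>push\<close> or
  of its inverse undoes this. The map \<open>e\<close> contracts the left side, except a
  neighbourhood of \<open>zeros\<close>, into that region. So \<open>t\<close> is trivial on the
  controlled left part, while on the right it equals \<open>j\<close> because \<open>e\<close> and
  \<open>g\<close> are trivial there. Dividing \<open>k0\<close> by \<open>t\<close> glues
  \<open>k0\<close> and \<open>k1\<close>.\<close>

lemma glue_mid:
  assumes k: "k0 \<in> K" "k1 \<in> K" "k0 mid = k1 mid"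
  shows "\<exists>k\<in>K. (\<forall>x. less_fun x mid \<longrightarrow> x \<notin> cylinder (replicate N False) \<longrightarrow> k x = k0 x) \<and>
    (\<forall>x. \<not> less_fun x mid \<longrightarrow> k x = k1 x)"
proof -
  note o = K_order[OF k(1)] K_order[OF k(2)]
  define j where "j = finv k1 \<circ> k0"
  have jK: "j \<in> K" using k by (simp add: j_def K_comp K_inv)
  have "j (wcat [] mid) = wcat [] mid"
    using k(3) o by (simp add: j_def)
  then have j_ones: "j (False ## ones) = False ## ones"
    using order_auto_predecessor[OF K_order[OF jK], of "[]" "[]"] by simp
  obtain u v where uv: "2 \<le> length u" "2 \<le> length v" "False ## ones \<in> cylinder u"
    "j (False ## ones) \<in> cylinder v" "maps_cyl j u v"
    using K_pl_auto[OF jK] by (rule pl_auto_long_cylinders)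
  have form: "w = [False, True] @ replicate (length w - 2) True" if "2 \<le> length w" "False ## ones \<in> cylinder w" for w
  proof (rule cylinder_length_unique[OF that(2)])
    show "False ## ones \<in> cylinder ([False, True] @ replicate (length w - 2) True)"
      unfolding cylinder_iff by (intro exI[of _ ones]) simp
  qed (use that(1) in simp)
  obtain n n' where u: "u = [False, True] @ replicate n True" and v: "v = [False, True] @ replicate n' True"
    using form[of u] form[of v] uv(1-4) j_ones by metis
  obtain g where g: "g \<in> K" "maps_cyl g v u" "\<And>x. x \<in> cylinder [True] \<Longrightarrow> g x = x"
    using shift_words[of push "\<lambda>n. [False, True] @ replicate n True" "cylinder [True]" n' n,
        OF push_in_K push_01 push_outside]
    unfolding u v by blast
  define e where "e = push ^^ (N + n)"
  have eK: "e \<in> K" by (simp add: e_def K_funpow push_in_K)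
  have "(push ^^ m) x = x" if "x \<in> cylinder [True]" for m x
    using that by (induction m) (simp_all add: push_outside)
  then have e_fix: "e x = x" if "x \<in> cylinder [True]" for x
    using that by (simp add: e_def)
  define t where "t = finv e \<circ> g \<circ> j \<circ> e"
  have tK: "t \<in> K" using g(1) eK jK by (simp add: t_def K_comp K_inv)
  show ?thesis
  proof (intro bexI[of _ "k0 \<circ> finv t"] conjI allI impI)
    show "k0 \<circ> finv t \<in> K" using k tK by (simp add: K_comp K_inv)
  next
    fix x assume x: "less_fun x mid" "x \<notin> cylinder (replicate N False)"
    then have "e x \<in> cylinder u"
      unfolding e_def u using push_funpow_into[of x N n] by (simp add: less_mid)
    then obtain y where "e x = wcat u y" by (rule cylinderE)
    then have "g (j (e x)) = e x"
      using uv(5) g(2) by (simp add: maps_cyl_def)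
    then have "t x = x"
      using K_order[OF eK] by (simp add: t_def)
    then have "finv t x = x"
      using K_order[OF tK] by (simp add: order_auto_finv_eq)
    then show "(k0 \<circ> finv t) x = k0 x" by simp
  next
    fix x assume x: "\<not> less_fun x mid"
    define y where "y = finv k0 (k1 x)"
    have "less_fun y mid \<longleftrightarrow> less_fun (k1 x) (k1 mid)"
      unfolding y_def using o k(3) by (simp add: order_auto_less_finv)
    then have "\<not> less_fun y mid" using x o by (simp add: order_auto_less)
    then have "e y = y" "e x = x" "g x = x"
      using x e_fix g(3) by (simp_all add: not_less_mid)
    moreover have "j y = x" using o by (simp add: j_def y_def)
    ultimately have "t y = x"
      using K_order[OF eK] by (simp add: t_def order_auto_finv_eq)
    then have "finv t x = y"
      using K_order[OF tK] by (simp add: order_auto_finv_eq)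
    then show "(k0 \<circ> finv t) x = k1 x"
      using o by (simp add: y_def)
  qed
qed

text \<open>
  Two elements of \<open>K\<close> that agree at the cut \<open>c\<close> can be glued there, except that the result is out of
  control on an arbitrarily small neighbourhood of the left end point.
\<close>

lemma glue:
  assumes h: "h \<in> K" "h mid = c" and k: "k0 \<in> K" "k1 \<in> K" "k0 c = k1 c"
  obtains k where "k \<in> K" "\<And>x. less_fun x c \<Longrightarrow> x \<notin> cylinder (replicate N False) \<Longrightarrow> k x = k0 x"
    "\<And>x. \<not> less_fun x c \<Longrightarrow> k x = k1 x"
proof -
  have o: "order_auto h" using h(1) by (rule K_order)
  \<comment> \<open>The neighbourhood 0^a lost in gluing at \<open>mid\<close> is carried by
    \<open>h\<close> to 0^b; as \<open>b\<close> is at least \<open>N\<close>, it lies inside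
    0^N.\<close>
  obtain a b where ab: "N \<le> a" "N \<le> b" "maps_cyl h (replicate a False) (replicate b False)"
    using K_pl_auto[OF h(1)] by (rule pl_auto_at_zeros)
  have less: "less_fun (finv h x) mid \<longleftrightarrow> less_fun x c" for x
    using order_auto_less_finv[OF o] h(2) by simp
  obtain k where kK: "k \<in> K"
    and k0: "\<And>x. less_fun x mid \<Longrightarrow> x \<notin> cylinder (replicate a False) \<Longrightarrow> k x = (k0 \<circ> h) x"
    and k1: "\<And>x. \<not> less_fun x mid \<Longrightarrow> k x = (k1 \<circ> h) x"
    using glue_mid[of "k0 \<circ> h" "k1 \<circ> h" a] h k by (auto simp: K_comp)
  show ?thesis
  proof (rule that[of "k \<circ> finv h"])
    show "k \<circ> finv h \<in> K" using kK h by (simp add: K_comp K_inv)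
    fix x
    show "(k \<circ> finv h) x = k1 x" if "\<not> less_fun x c"
      using that less k1[of "finv h x"] o by simp
    assume x: "less_fun x c" "x \<notin> cylinder (replicate N False)"
    have "finv h x \<notin> cylinder (replicate a False)"
      using maps_cyl_in_iff[OF o ab(3), of "finv h x"] o x(2) cylinder_replicate_mono[OF ab(2), of False]
      by auto
    then show "(k \<circ> finv h) x = k0 x"
      using x(1) less k0[of "finv h x"] o by simp
  qed
qed

lemma cut_01: "\<exists>h\<in>K. h mid = False ## mid"
proof (rule bexI[OF _ lift_in_K[OF pl_auto_rot_inv]])
  \<comment> \<open>\<open>phi ^^ i\<close> fixes \<open>mid\<close>, and writing \<open>mid\<close>
    as 10 followed by zeros makes the inverse rotation applicable.\<close>
  have "lift rot_inv ((phi ^^ i) mid) = (phi ^^ i) (rot_inv (True ## False ## zeros))"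
    by (simp only: lift_phi scons_zeros)
  then show "lift rot_inv mid = False ## mid"
    by (simp only: rot_inv_simps) simp
qed

lemma cut_011: "\<exists>h\<in>K. h mid = False ## True ## mid"
proof (rule bexI[OF _ lift_in_K[OF pl_auto_comp[OF pl_auto_rot_inv pl_auto_act[OF pl_auto_rot]]]])
  have "lift (act [False] rot \<circ> rot_inv) ((phi ^^ i) mid) =
      (phi ^^ i) (act [False] rot (rot_inv (True ## False ## zeros)))"
    by (simp only: lift_phi scons_zeros o_apply)
  then show "lift (act [False] rot \<circ> rot_inv) mid = False ## True ## mid"
    by (simp only: rot_inv_simps) simp
qed

end

section \<open>Overgroups that shift the parity of a run of zeros are all of F\<close>

locale aperiodic_overgroup = overgroup +
  assumes aperiodic: "sim [False, True, False] [False, True, False, False]"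
begin

text \<open>On the left half of 01 aperiodicity provides 010 to 0100; on the right half every
  overgroup provides 011 to 0101. Both agree at the cut 011000..., so they can be glued, and the
  error inside 00 does not touch 01.\<close>

lemma sim_01_010: "sim [False, True] [False, True, False]"
proof -
  obtain k0 where k0: "k0 \<in> K" "maps_cyl k0 [False, True, False] [False, True, False, False]"
    using aperiodic by (auto simp: sim_def)
  obtain k1 where k1: "k1 \<in> K" "maps_cyl k1 [False, True, True] [False, True, False, True]"
    using sim_trans[OF sim_sym[OF sim_01_011] sim_01_0101] by (auto simp: sim_def)
  obtain h where h: "h \<in> K" "h mid = False ## True ## mid"
    using cut_011 by blast
  have "k0 (wcat [False, True] mid) = wcat [False, True, False] mid"
    using order_auto_successor[OF K_order[OF k0(1)], of "[False, True]" "[False, True, False]"]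
      maps_cylD[OF k0(2), of ones] by simp
  then have eq: "k0 (False ## True ## mid) = k1 (False ## True ## mid)"
    using maps_cylD[OF k1(2), of zeros] by simp
  obtain k where k: "k \<in> K"
    "\<And>x. less_fun x (False ## True ## mid) \<Longrightarrow> x \<notin> cylinder (replicate 2 False) \<Longrightarrow> k x = k0 x"
    "\<And>x. \<not> less_fun x (False ## True ## mid) \<Longrightarrow> k x = k1 x"
    using glue[OF h k0(1) k1(1) eq, of 2] by metis
  have "maps_cyl k [False, True] [False, True, False]"
    unfolding maps_cyl_def
  proof
    fix \<omega>
    obtain a y where \<omega>: "\<omega> = a ## y" by (rule cantor_cases)
    show "k (wcat [False, True] \<omega>) = wcat [False, True, False] \<omega>"
      using k(2)[of "wcat [False, True] \<omega>"] k(3)[of "wcat [False, True] \<omega>"]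
        maps_cylD[OF k0(2), of y] maps_cylD[OF k1(2), of y]
      by (cases a) (simp_all add: \<omega> zeros_least numeral_2_eq_2)
  qed
  with k(1) show ?thesis by (auto simp: sim_def)
qed

lemma sim_01_append: "sim [False, True] ([False, True] @ w)"
proof (induction w)
  case (Cons a w)
  have "sim [False, True] [False, True, a]"
    using sim_01_010 sim_01_011 by (cases a) simp_all
  from sim_append[OF this, of w] Cons show ?case
    using sim_trans by simp
qed (simp add: sim_refl)

lemma sim_01_extensions:
  obtains k where "k \<in> K" "maps_cyl k ([False, True] @ u) ([False, True] @ v)"
  using sim_trans[OF sim_sym[OF sim_01_append] sim_01_append, of u v] by (auto simp: sim_def)

text \<open>The rotation inside 01 is assembled from left to right out of the identity, 0100 to 010,
  0101 to 0110, 011 to 0111, and the identity again. Neighbouring pieces agree at the four cuts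
  because a piece also determines the value just beyond the following gap. All errors lie inside
  0^N.\<close>

lemma approximate_rot:
  obtains y where "y \<in> K" "\<And>x. x \<notin> cylinder (replicate M False) \<Longrightarrow> y x = act [False, True] rot x"
proof -
  define N where "N = M + 2"
  obtain ka where ka: "ka \<in> K" "maps_cyl ka [False, True, False, False] [False, True, False]"
    using sim_01_extensions[of "[False, False]" "[False]"] by auto
  obtain kb where kb: "kb \<in> K" "maps_cyl kb [False, True, False, True] [False, True, True, False]"
    using sim_01_extensions[of "[False, True]" "[True, False]"] by auto
  obtain kc where kc: "kc \<in> K" "maps_cyl kc [False, True, True] [False, True, True, True]"
    using sim_01_extensions[of "[True]" "[True, True]"] by auto
  obtain h1 where h1: "h1 \<in> K" "h1 mid = False ## mid"
    using cut_01 by blast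
  obtain h3 where h3: "h3 \<in> K" "h3 mid = False ## True ## mid"
    using cut_011 by blast
  \<comment> \<open>An element replacing 01 by 010 produces the missing cut 0101000... from
    011000....\<close>
  obtain k where k: "k \<in> K" "maps_cyl k [False, True] [False, True, False]"
    using sim_01_extensions[of "[]" "[False]"] by auto
  have h2: "k \<circ> h3 \<in> K" "(k \<circ> h3) mid = False ## True ## False ## mid"
    using k h3 maps_cylD[OF k(2), of mid] by (simp_all add: K_comp)
  have "id (False ## mid) = ka (False ## mid)"
    using maps_cylD[OF ka(2), of zeros] by simp
  then obtain y1 where y1: "y1 \<in> K"
    "\<And>x. less_fun x (False ## mid) \<Longrightarrow> x \<notin> cylinder (replicate N False) \<Longrightarrow> y1 x = id x"
    "\<And>x. \<not> less_fun x (False ## mid) \<Longrightarrow> y1 x = ka x"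
    using glue[OF h1 K_id ka(1), of N] by metis
  have "y1 (False ## True ## False ## mid) = ka (False ## True ## False ## mid)"
    by (rule y1(3)) (simp add: zeros_least)
  also have "\<dots> = kb (False ## True ## False ## mid)"
    using order_auto_successor[OF K_order[OF ka(1)], of "[False, True, False]" "[False, True]"]
      maps_cylD[OF ka(2), of ones] maps_cylD[OF kb(2), of zeros] by simp
  finally obtain y2 where y2: "y2 \<in> K"
    "\<And>x. less_fun x (False ## True ## False ## mid) \<Longrightarrow> x \<notin> cylinder (replicate N False) \<Longrightarrow> y2 x = y1 x"
    "\<And>x. \<not> less_fun x (False ## True ## False ## mid) \<Longrightarrow> y2 x = kb x"
    using glue[OF h2 y1(1) kb(1), of N] by metis
  have "y2 (False ## True ## mid) = kb (False ## True ## mid)"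
    by (rule y2(3)) (simp add: zeros_least)
  also have "\<dots> = kc (False ## True ## mid)"
    using order_auto_successor[OF K_order[OF kb(1)], of "[False, True]" "[False, True, True]"]
      maps_cylD[OF kb(2), of ones] maps_cylD[OF kc(2), of zeros] by simp
  finally obtain y3 where y3: "y3 \<in> K"
    "\<And>x. less_fun x (False ## True ## mid) \<Longrightarrow> x \<notin> cylinder (replicate N False) \<Longrightarrow> y3 x = y2 x"
    "\<And>x. \<not> less_fun x (False ## True ## mid) \<Longrightarrow> y3 x = kc x"
    using glue[OF h3 y2(1) kc(1), of N] by metis
  have "y3 mid = kc mid"
    by (rule y3(3)) simp
  also have "\<dots> = id mid"
    using order_auto_successor[OF K_order[OF kc(1)], of "[]" "[]"]
      maps_cylD[OF kc(2), of ones] by simp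
  finally obtain y4 where y4: "y4 \<in> K"
    "\<And>x. less_fun x mid \<Longrightarrow> x \<notin> cylinder (replicate N False) \<Longrightarrow> y4 x = y3 x"
    "\<And>x. \<not> less_fun x mid \<Longrightarrow> y4 x = id x"
    using glue[OF K_id _ y3(1) K_id, of mid N] by (metis id_apply)
  have "y4 x = act [False, True] rot x" if "x \<notin> cylinder (replicate M False)" for x
  proof -
    have N: "x \<notin> cylinder (replicate N False)"
      using that cylinder_replicate_mono[of M N False] by (auto simp: N_def)
    note y = y4(2)[OF _ N] y3(2)[OF _ N] y2(2)[OF _ N] y1(2)[OF _ N] y4(3)[of x] y3(3)[of x] y2(3)[of x] y1(3)[of x]
    obtain a z where a: "x = a ## z" by (rule cantor_cases)
    obtain b w where b: "z = b ## w" by (rule cantor_cases)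
    show ?thesis
    proof (cases w rule: cantor_cases3)
      case (1 w')
      then show ?thesis
        using y maps_cylD[OF kc(2), of w'] by (cases a; cases b) (simp_all add: a b zeros_least)
    next
      case (2 w')
      then show ?thesis
        using y maps_cylD[OF kb(2), of w'] by (cases a; cases b) (simp_all add: a b zeros_least)
    next
      case (3 w')
      then show ?thesis
        using y maps_cylD[OF ka(2), of w'] by (cases a; cases b) (simp_all add: a b zeros_least)
    qed
  qed
  with y4(1) show ?thesis by (rule that)
qed

lemma order_auto_act_rot: "order_auto (act u rot)"
  by (intro order_auto_act pl_auto_order_auto pl_auto_rot)

lemma disjoint_00_01:
  "x \<in> cylinder (replicate (M + 2) False) \<Longrightarrow> x \<notin> cylinder ([False, True] @ w)"
  by (cases x rule: cantor_cases3) (auto simp: numeral_2_eq_2)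

text \<open>
  The error of the approximation \<open>y\<close> lives where \<open>k\<close> is the identity, so it cancels in the commutator of \<open>k\<close> and \<open>y\<close>.
\<close>

lemma rot_quotient_in_K: "act ([False, True] @ w) rot \<circ> finv (act [False, True] rot) \<in> K"
proof -
  let ?p = "act [False, True] rot" and ?r = "act ([False, True] @ w) rot"
  obtain k where k: "k \<in> K" "maps_cyl k [False, True] ([False, True] @ w)"
    using sim_01_extensions[of "[]" w] by auto
  obtain a b where ab: "3 \<le> a" "3 \<le> b" "maps_cyl k (replicate a False) (replicate b False)"
    using K_pl_auto[OF k(1)] by (rule pl_auto_at_zeros)
  \<comment> \<open>This element fixes the cylinder of 01 and lengthens prefixes of at least three
    zeros by one. Powers of it or its inverse correct \<open>k\<close> near \<open>zeros\<close>
    without changing \<open>k\<close> on 01.\<close>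
  have "lift (act [False, False] rot_inv) x = x" if x: "x \<in> cylinder [False, True]" for x
  proof -
    obtain y where "x = wcat [False, True] y" using x by (rule cylinderE)
    moreover obtain z where "y = (phis SR ^^ i) z" using surj_R by (rule surjE)
    ultimately have "x = (phi ^^ i) (False ## True ## z)" by simp
    then show ?thesis by (simp only: lift_phi act_Cons_scons) simp
  qed
  moreover have "maps_cyl (lift (act [False, False] rot_inv)) (replicate (n + 3) False) (replicate (Suc n + 3) False)" for n
    by (rule maps_cyl_lift[of "replicate (n + 3) False" _ "phi ^^ i" "replicate (Suc n + 3) False"])
      (simp_all only: phi_funpow_replicate_False surj_phi, simp add: maps_cyl_def numeral_3_eq_3)
  ultimately obtain g where g: "g \<in> K" "maps_cyl g (replicate b False) (replicate a False)"
    "\<And>x. x \<in> cylinder [False, True] \<Longrightarrow> g x = x"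
    using shift_words[of "lift (act [False, False] rot_inv)" "\<lambda>n. replicate (n + 3) False" "cylinder [False, True]" "b - 3" "a - 3"]
      lift_in_K[OF pl_auto_act[OF pl_auto_rot_inv]] ab by auto
  define k' where "k' = k \<circ> g"
  have k'K: "k' \<in> K" using k g by (simp add: k'_def K_comp)
  note k'o = K_order[OF k'K]
  have k': "maps_cyl k' [False, True] ([False, True] @ w)" "maps_cyl k' (replicate b False) (replicate b False)"
    using maps_cyl_comp[OF g(2) ab(3)] k(2) g(3) by (auto simp: maps_cyl_def k'_def)
  define M where "M = b - 2"
  have b: "b = M + 2" using ab by (simp add: M_def)
  obtain y where y: "y \<in> K" "\<And>x. x \<notin> cylinder (replicate b False) \<Longrightarrow> y x = ?p x"
    using approximate_rot[of b] by blast
  note yo = K_order[OF y(1)]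
  have k'_b: "k' x = x" if "x \<in> cylinder (replicate b False)" for x
    using that k'(2) by (auto simp: cylinder_iff maps_cyl_def)
  \<comment> \<open>Inside 0^b the maps \<open>k'\<close>, \<open>?p\<close> and \<open>?r\<close>
    are trivial. Outside, \<open>y\<close> is the rotation \<open>?p\<close>, which
    \<open>k'\<close> conjugates to \<open>?r\<close>.\<close>
  have "k' (y x) = ?r (finv ?p (y (k' x)))" for x
  proof (cases "x \<in> cylinder (replicate b False)")
    case True
    \<comment> \<open>\<open>y\<close> preserves 0^b: outside it \<open>y\<close> agrees with
      \<open>?p\<close>, which already fills the whole complement.\<close>
    have yx: "y x \<in> cylinder (replicate b False)"
    proof (rule ccontr)
      assume not: "y x \<notin> cylinder (replicate b False)"
      define z where "z = finv ?p (y x)"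
      have pz: "?p z = y x" by (simp add: z_def order_auto_act_rot)
      have "z \<notin> cylinder (replicate b False)"
      proof
        assume z: "z \<in> cylinder (replicate b False)"
        then have "z \<notin> cylinder [False, True]" using disjoint_00_01[of z M "[]"] b by simp
        then have "?p z = z" by (rule act_outside)
        with z pz not show False by simp
      qed
      then have "y z = y x" using y(2) pz by simp
      then have "z = x" by (metis yo order_auto_inv_inv(1))
      with True \<open>z \<notin> cylinder (replicate b False)\<close> show False by simp
    qed
    then have "y x \<notin> cylinder [False, True]" "y x \<notin> cylinder ([False, True] @ w)"
      using disjoint_00_01[of "y x" M "[]"] disjoint_00_01[of "y x" M w] b by simp_all
    from act_outside[OF this(1)] act_outside[OF this(2)]
    have "?p (y x) = y x" "?r (y x) = y x"
      by blast+
    moreover from this have "finv ?p (y x) = y x"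
      using order_auto_finv_eq[OF order_auto_act_rot] by metis
    ultimately show ?thesis using yx True by (simp only: k'_b)
  next
    case False
    then have "k' x \<notin> cylinder (replicate b False)"
      using maps_cyl_in_iff[OF k'o k'(2)] by simp
    then have "y (k' x) = ?p (k' x)" "y x = ?p x"
      using False y(2) by blast+
    moreover have "k' (?p x) = ?r (k' x)"
      using fun_cong[OF conj_act[OF k'o k'(1), of rot], of "k' x"] k'o by simp
    ultimately show ?thesis
      by (simp add: order_auto_act_rot)
  qed
  then have "k' (y (finv k' (finv y z))) = ?r (finv ?p z)" for z
    using k'o yo by simp
  then have "?r \<circ> finv ?p = k' \<circ> y \<circ> finv k' \<circ> finv y" by auto
  then show ?thesis
    using k'K y(1) by (simp only: K_comp K_inv)
qed

text \<open>On 01 the approximation \<open>y\<close> equals the rotation, and it preserves the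
  complement, where \<open>a\<close> is trivial. So conjugating \<open>a\<close> by \<open>y\<close>
  has the same effect as conjugating by the rotation.\<close>

lemma conj_rot_in_K:
  assumes a: "a \<in> K" "\<And>x. x \<notin> cylinder [False, True] \<Longrightarrow> a x = x"
  defines "p \<equiv> act [False, True] rot"
  shows "p \<circ> a \<circ> finv p \<in> K"
proof -
  have po: "order_auto p" by (simp add: p_def order_auto_act_rot)
  have p: "p x \<in> cylinder [False, True] \<longleftrightarrow> x \<in> cylinder [False, True]" for x
    unfolding p_def by (rule act_in_cylinder_iff[OF pl_auto_order_auto[OF pl_auto_rot]])
  obtain y where y: "y \<in> K" "\<And>x. x \<notin> cylinder (replicate 2 False) \<Longrightarrow> y x = p x"
    unfolding p_def using approximate_rot[of 2] by blast
  note yo = K_order[OF y(1)]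
  have yp: "y x = p x" if "x \<in> cylinder [False, True]" for x
  proof (rule y(2))
    show "x \<notin> cylinder (replicate 2 False)"
      using that disjoint_00_01[of x 0 "[]"] by (auto simp: numeral_2_eq_2)
  qed
  have y01: "x \<in> cylinder [False, True]" if "y x \<in> cylinder [False, True]" for x
  proof -
    define z where "z = finv p (y x)"
    have "p z = y x" using po by (simp add: z_def)
    moreover from this have "z \<in> cylinder [False, True]" using p[of z] that by simp
    ultimately have "y z = y x" using yp by simp
    then have "z = x" by (metis yo order_auto_inv_inv(1))
    with \<open>z \<in> cylinder [False, True]\<close> show ?thesis by simp
  qed
  have a01: "a x \<in> cylinder [False, True]" if "x \<in> cylinder [False, True]" for x
  proof (rule ccontr)
    assume "a x \<notin> cylinder [False, True]"
    then have "a (a x) = a x" by (rule a(2))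
    then have "a x = x" by (metis K_order[OF a(1)] order_auto_inv_inv(1))
    with that \<open>a x \<notin> cylinder [False, True]\<close> show False by simp
  qed
  have "p (a (finv p (y x))) = y (a x)" for x
  proof (cases "x \<in> cylinder [False, True]")
    case True
    then show ?thesis using yp a01 po by simp
  next
    case False
    then have "y x \<notin> cylinder [False, True]" using y01 by blast
    then have px: "p (y x) = y x" unfolding p_def by (rule act_outside)
    then have "finv p (y x) = y x" using po order_auto_finv_eq by metis
    then show ?thesis using a(2) False \<open>y x \<notin> cylinder [False, True]\<close> px by simp
  qed
  from this[of "finv y _"] have "p \<circ> a \<circ> finv p = y \<circ> a \<circ> finv y"
    using yo by auto
  then show ?thesis
    using y(1) a(1) by (simp only: K_comp K_inv)
qed

text \<open>Let x, x0, x1 be the rotations inside 01, 010, 011. \<open>K\<close> contains the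
  quotients a = x0 x^-1 and b = x1 x^-1, and by conjugating twice also x^2 a x^-2. By the pentagon
  x^2 = x1 x x0, the product b x^2 a x^-2 = x1 x x0 x^-3 equals x^-1.\<close>

lemma rot_01_in_K: "act [False, True] rot \<in> K"
proof -
  define p where "p = act [False, True] rot"
  define a where "a = act [False, True, False] rot \<circ> finv p"
  define b where "b = act [False, True, True] rot \<circ> finv p"
  have po: "order_auto p" by (simp add: p_def order_auto_act_rot)
  have aK: "a \<in> K" and bK: "b \<in> K"
    using rot_quotient_in_K[of "[False]"] rot_quotient_in_K[of "[True]"] by (simp_all add: a_def b_def p_def)
  have p_out: "p x = x" "finv p x = x" if "x \<notin> cylinder [False, True]" for x
  proof -
    show "p x = x" using that unfolding p_def by (rule act_outside)
    then show "finv p x = x" using po order_auto_finv_eq by metis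
  qed
  have a_out: "a x = x" if "x \<notin> cylinder [False, True]" for x
  proof -
    have "x \<notin> cylinder [False, True, False]"
      using that cylinder_append_subset[of "[False, True]" "[False]"] by auto
    with that p_out show ?thesis by (simp add: a_def act_outside)
  qed
  define a' where "a' = p \<circ> a \<circ> finv p"
  have a'K: "a' \<in> K"
    unfolding a'_def p_def by (rule conj_rot_in_K[OF aK]) (rule a_out)
  have a'_out: "a' x = x" if "x \<notin> cylinder [False, True]" for x
    using that p_out a_out by (simp add: a'_def)
  define a'' where "a'' = p \<circ> a' \<circ> finv p"
  have a''K: "a'' \<in> K"
    unfolding a''_def p_def by (rule conj_rot_in_K[OF a'K]) (rule a'_out)
  have pent: "p \<circ> p = act [False, True, True] rot \<circ> p \<circ> act [False, True, False] rot"
    using arg_cong[OF rot_pentagon, of "act [False, True]"]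
    by (simp add: p_def act_comp flip: act_act)
  have "b (a'' (p x)) = x" for x
  proof -
    define z where "z = finv p x"
    have "b (a'' (p x)) = act [False, True, True] rot (p (act [False, True, False] rot (finv p z)))"
      using po by (simp add: a''_def a'_def a_def b_def z_def)
    also have "\<dots> = p (p (finv p z))"
      using fun_cong[OF pent, of "finv p z"] by simp
    also have "\<dots> = x" using po by (simp add: z_def)
    finally show ?thesis .
  qed
  then have "finv (b \<circ> a'') x = p x" for x
    using K_order[OF K_comp[OF bK a''K]] by (simp add: order_auto_finv_eq)
  then have "p = finv (b \<circ> a'')" by (intro ext) simp
  then show ?thesis
    using K_inv[OF K_comp[OF bK a''K]] by (simp add: p_def)
qed

text \<open>Conjugation inside \<open>K\<close> spreads the rotation at 01 to all extensions of 01,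
  and these rotations generate.\<close>

lemma act_01_in_K:
  assumes "pl_auto f"
  shows "act [False, True] f \<in> K"
proof (rule rot_generates[OF K _ assms])
  fix w
  obtain k where k: "k \<in> K" "maps_cyl k [False, True] ([False, True] @ w)"
    using sim_01_extensions[of "[]" w] by auto
  have "k \<circ> act [False, True] rot \<circ> finv k \<in> K"
    using k(1) rot_01_in_K by (simp only: K_comp K_inv)
  then show "act ([False, True] @ w) rot \<in> K"
    using conj_act[OF K_order[OF k(1)] k(2)] by simp
qed

text \<open>The lifted inverse rotation \<open>X\<close> sheds one leading 1 per application, so
  \<open>X ^^ c\<close> brings everything outside 1^c into the cylinder of 0; \<open>push\<close>
  then gathers it in 01.\<close>

lemma compress:
  obtains h where "h \<in> K"
    "\<And>x. x \<notin> cylinder (replicate a False) \<Longrightarrow> x \<notin> cylinder (replicate c True) \<Longrightarrow> h x \<in> cylinder [False, True]"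
proof -
  define X where "X = lift rot_inv"
  have XK: "X \<in> K" by (simp add: X_def lift_in_K pl_auto_rot_inv)
  have X0: "X x \<in> cylinder [False]" if x: "x \<in> cylinder [False]" for x
  proof -
    obtain y where "x = wcat [False] y" using x by (rule cylinderE)
    moreover obtain z where "y = (phi ^^ i) z" by (rule phi_preimage)
    ultimately have "x = (phi ^^ i) (False ## z)" by simp
    then have "X x = (phi ^^ i) (rot_inv (False ## z))" by (simp only: X_def lift_phi)
    then show ?thesis by simp
  qed
  have X1: "X x \<in> cylinder (replicate j True @ [False])" if x: "x \<in> cylinder (replicate (Suc j) True @ [False])" for j x
  proof -
    obtain y where "x = wcat (replicate (Suc j) True @ [False]) y" using x by (rule cylinderE)
    moreover obtain z where "y = (phis SA ^^ i) z" using surj_A by (rule surjE)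
    ultimately have "x = (phi ^^ i) (wcat (replicate (Suc j) True @ [False]) z)" by simp
    then have "X x = (phi ^^ i) (rot_inv (wcat (replicate (Suc j) True @ [False]) z))"
      by (simp only: X_def lift_phi)
    then show ?thesis by (cases j) simp_all
  qed
  have X0n: "(X ^^ n) x \<in> cylinder [False]" if "x \<in> cylinder [False]" for n x
    using that by (induction n) (simp_all only: funpow.simps id_apply o_apply X0)
  have X1n: "(X ^^ (j + n)) x \<in> cylinder [False]" if "x \<in> cylinder (replicate j True @ [False])" for j n x
    using that
  proof (induction j arbitrary: x)
    case 0
    then show ?case using X0n by simp
  next
    case (Suc j)
    then have "(X ^^ (j + n)) (X x) \<in> cylinder [False]" using X1 by blast
    then show ?case by (simp add: funpow_swap1)
  qed
  have "X ^^ c \<in> K" using XK by (rule K_funpow)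
  \<comment> \<open>Points outside 0^a stay outside 0^a' under \<open>X ^^ c\<close>, which bounds
    the number of pushes needed.\<close>
  obtain a' b' where ab: "a \<le> a'" "a \<le> b'" "maps_cyl (finv (X ^^ c)) (replicate a' False) (replicate b' False)"
    using K_pl_auto[OF K_inv[OF \<open>X ^^ c \<in> K\<close>]] by (rule pl_auto_at_zeros)
  show ?thesis
  proof (rule that[of "push ^^ a' \<circ> X ^^ c"])
    show "push ^^ a' \<circ> X ^^ c \<in> K"
      using \<open>X ^^ c \<in> K\<close> push_in_K by (simp add: K_comp K_funpow)
    fix x assume x: "x \<notin> cylinder (replicate a False)" "x \<notin> cylinder (replicate c True)"
    obtain j where j: "j < c" "x \<in> cylinder (replicate j True @ [False])"
      using not_in_cylinder_replicate[OF x(2)] by auto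
    then have "(X ^^ c) x \<in> cylinder [False]"
      using X1n[of x j "c - j"] by simp
    moreover have "(X ^^ c) x \<notin> cylinder (replicate a' False)"
    proof
      assume "(X ^^ c) x \<in> cylinder (replicate a' False)"
      then have "finv (X ^^ c) ((X ^^ c) x) \<in> cylinder (replicate b' False)"
        using ab(3) by (auto simp: cylinder_iff maps_cyl_def)
      then have "x \<in> cylinder (replicate b' False)"
        using K_order[OF \<open>X ^^ c \<in> K\<close>] by simp
      with x(1) cylinder_replicate_mono[OF ab(2), of False] show False by blast
    qed
    ultimately show "(push ^^ a' \<circ> X ^^ c) x \<in> cylinder [False, True]"
      using push_funpow_into[of "(X ^^ c) x" a' 0] by simp
  qed
qed

text \<open>Elements of \<open>K\<close> correct \<open>f\<close> at both ends to a map
  \<open>f'\<close> that is trivial on 0^a and 1^c. Conjugation by the compressing map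
  \<open>s\<close> moves the support of \<open>f'\<close> into 01, where \<open>K\<close> contains
  everything.\<close>

lemma pl_auto_in_K:
  assumes f: "pl_auto f"
  shows "f \<in> K"
proof -
  obtain a b where ab: "2 \<le> a" "2 \<le> b" "maps_cyl f (replicate a False) (replicate b False)"
    using f by (rule pl_auto_at_zeros)
  obtain c d where cd: "2 \<le> c" "2 \<le> d" "maps_cyl f (replicate c True) (replicate d True)"
    using f by (rule pl_auto_at_ones)
  obtain a' b' c' d' where abcd: "a = a' + 2" "b = b' + 2" "c = c' + 2" "d = d' + 2"
    using ab(1,2) cd(1,2) by (metis add.commute le_Suc_ex)
  \<comment> \<open>\<open>phi\<close> copies leading zeros, so the lift lengthens prefixes of at
    least two zeros by one while fixing the cylinder of 1. The analogous lift for leading ones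
    follows.\<close>
  have "lift (act [False] rot_inv) x = x" if x: "x \<in> cylinder [True]" for x
  proof -
    obtain y where "x = wcat [True] y" using x by (rule cylinderE)
    moreover obtain z where "y = (phis SR ^^ i) z" using surj_R by (rule surjE)
    ultimately have "x = (phi ^^ i) (True ## z)" by simp
    then show ?thesis by (simp only: lift_phi act_Cons_scons) simp
  qed
  moreover have "maps_cyl (lift (act [False] rot_inv)) (replicate (n + 2) False) (replicate (Suc n + 2) False)" for n
    by (rule maps_cyl_lift[of "replicate (n + 2) False" _ "phi ^^ i" "replicate (Suc n + 2) False"])
      (simp_all only: phi_funpow_replicate_False surj_phi, simp add: maps_cyl_def numeral_2_eq_2)
  ultimately obtain g where g: "g \<in> K" "maps_cyl g (replicate b False) (replicate a False)"
    "\<And>x. x \<in> cylinder [True] \<Longrightarrow> g x = x"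
    using shift_words[of "lift (act [False] rot_inv)" "\<lambda>n. replicate (n + 2) False" "cylinder [True]" b' a']
      lift_in_K[OF pl_auto_act[OF pl_auto_rot_inv]] unfolding abcd by blast
  have "lift (act [True] rot) x = x" if x: "x \<in> cylinder [False]" for x
  proof -
    obtain y where "x = wcat [False] y" using x by (rule cylinderE)
    moreover obtain z where "y = (phi ^^ i) z" by (rule phi_preimage)
    ultimately have "x = (phi ^^ i) (False ## z)" by simp
    then show ?thesis by (simp only: lift_phi act_Cons_scons) simp
  qed
  moreover have "maps_cyl (lift (act [True] rot)) (replicate (n + 2) True) (replicate (Suc n + 2) True)" for n
    by (rule maps_cyl_lift[of "replicate (n + 2) True" _ "phis SR ^^ i" "replicate (Suc n + 2) True"])
      (simp_all add: maps_cyl_def numeral_2_eq_2 surj_R)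
  ultimately obtain h where h: "h \<in> K" "maps_cyl h (replicate d True) (replicate c True)"
    "\<And>x. x \<in> cylinder [False] \<Longrightarrow> h x = x"
    using shift_words[of "lift (act [True] rot)" "\<lambda>n. replicate (n + 2) True" "cylinder [False]" d' c']
      lift_in_K[OF pl_auto_act[OF pl_auto_rot]] unfolding abcd by blast
  define f' where "f' = h \<circ> g \<circ> f"
  have "pl_auto f'"
    using f h(1) g(1) by (simp add: f'_def pl_auto_comp K_pl_auto)
  have sub: "x \<in> cylinder [e]" if "x \<in> cylinder (replicate m e)" "2 \<le> m" for x m e
    using that cylinder_replicate_mono[of 1 m e] by auto
  have f'0: "f' x = x" if x0: "x \<in> cylinder (replicate a False)" for x
  proof -
    obtain y where x: "x = wcat (replicate a False) y" using x0 by (rule cylinderE)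
    then have "g (f x) = x"
      using maps_cylD[OF ab(3), of y] maps_cylD[OF g(2), of y] by simp
    moreover have "h x = x" using h(3) sub x0 ab(1) by blast
    ultimately show ?thesis by (simp add: f'_def)
  qed
  have f'1: "f' x = x" if x1: "x \<in> cylinder (replicate c True)" for x
  proof -
    obtain y where x: "x = wcat (replicate c True) y" using x1 by (rule cylinderE)
    then have fx: "f x = wcat (replicate d True) y"
      using maps_cylD[OF cd(3), of y] by simp
    moreover have "g (f x) = f x"
      using g(3) sub[of "f x" d True] cd(2) fx by simp
    ultimately show ?thesis
      using maps_cylD[OF h(2), of y] x by (simp add: f'_def)
  qed
  obtain s where s: "s \<in> K"
    "\<And>x. x \<notin> cylinder (replicate a False) \<Longrightarrow> x \<notin> cylinder (replicate c True) \<Longrightarrow> s x \<in> cylinder [False, True]"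
    using compress[of a c] by blast
  note so = K_order[OF s(1)]
  have "pl_auto (s \<circ> f' \<circ> finv s)"
    using \<open>pl_auto f'\<close> s(1) by (simp add: pl_auto_comp K_pl_auto K_inv)
  moreover have "(s \<circ> f' \<circ> finv s) x = x" if "x \<notin> cylinder [False, True]" for x
  proof -
    have "finv s x \<in> cylinder (replicate a False) \<or> finv s x \<in> cylinder (replicate c True)"
      using s(2)[of "finv s x"] so that by auto
    then have "f' (finv s x) = finv s x" using f'0 f'1 by blast
    then show ?thesis using so by simp
  qed
  ultimately obtain r where "pl_auto r" "s \<circ> f' \<circ> finv s = act [False, True] r"
    by (rule pl_auto_restrict)
  then have "s \<circ> f' \<circ> finv s \<in> K" using act_01_in_K by simp
  from K_comp[OF K_comp[OF K_inv[OF s(1)] this] s(1)]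
  have "finv s \<circ> (s \<circ> f' \<circ> finv s) \<circ> s \<in> K" .
  moreover have "finv s \<circ> (s \<circ> f' \<circ> finv s) \<circ> s = f'"
    using so by auto
  ultimately have "f' \<in> K" by (simp only:)
  then have "finv g \<circ> (finv h \<circ> f') \<in> K"
    using g(1) h(1) by (intro K_comp K_inv)
  moreover have "finv g \<circ> (finv h \<circ> f') = f"
    using K_order[OF g(1)] K_order[OF h(1)] by (auto simp: f'_def)
  ultimately show ?thesis by (simp only:)
qed

end

section \<open>Descent along the chain of the groups \<open>H_group\<close>\<close>

lemma overgroup_eq_thompson_F:
  assumes G: "bij_group K" "K \<subseteq> thompson_F" "H_group (Suc j) \<subseteq> K"
    and f: "f \<in> K" "\<not> pl_auto (finv phi \<circ> f \<circ> phi)"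
  shows "K = thompson_F"
proof -
  interpret overgroup "Suc j" K
  proof
    show "bij_group K" by (rule G(1))
    show "pl_auto f" if "f \<in> K" for f
      using that G(2) thompson_F_imp_pl_auto by blast
    show "(phi ^^ Suc j) \<circ> f \<circ> finv (phi ^^ Suc j) \<in> K" if "pl_auto f" for f
      using that G(3) pl_auto_imp_thompson_F unfolding H_group_def by blast
  qed
  interpret aperiodic_overgroup "Suc j" K
    by unfold_locales (rule sim_010_0100[OF refl f])
  show ?thesis
    using G(2) pl_auto_in_K thompson_F_imp_pl_auto by blast
qed

lemma H_group_0: "H_group 0 = thompson_F"
  by (auto simp: H_group_def inv_id simp flip: id_def)

lemma H_group_Suc: "H_group (Suc j) = (\<lambda>g. phi \<circ> g \<circ> finv phi) ` H_group j"
proof -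
  have b: "bij phi" "bij (phi ^^ j)"
    by (simp_all add: order_auto_bij order_auto_phi order_auto_funpow)
  have "(phi ^^ Suc j) \<circ> f \<circ> finv (phi ^^ Suc j) = phi \<circ> ((phi ^^ j) \<circ> f \<circ> finv (phi ^^ j)) \<circ> finv phi" for f
    using o_inv_distrib[OF b] by (simp add: o_assoc)
  then show ?thesis
    unfolding H_group_def by (auto simp: image_iff)
qed

text \<open>On \<open>UNIV\<close> extensionality is vacuous, so the operations of
  \<open>BijGroup\<close> are plain composition and inverse.\<close>

lemma bij_group_BijGroup:
  assumes "subgroup K (BijGroup UNIV)"
  shows "bij_group K"
proof -
  interpret subgroup K "BijGroup UNIV" by (rule assms)
  interpret G: group "BijGroup UNIV :: ('a \<Rightarrow> 'a) monoid" by (rule group_BijGroup)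
  have bij: "f \<in> Bij UNIV" if "f \<in> K" for f
    using that subset by (auto simp: BijGroup_def)
  have bij': "bij f" if "f \<in> K" for f
    using bij[OF that] by (simp add: Bij_def)
  have mult: "f \<circ> g \<in> K" if "f \<in> K" "g \<in> K" for f g
    using m_closed[OF that] bij that by (simp add: BijGroup_def compose_def comp_def restrict_def)
  have one: "id \<in> K"
    using one_closed by (simp add: BijGroup_def id_def restrict_def)
  moreover have "finv f \<in> K" if "f \<in> K" for f
  proof -
    have "m_inv (BijGroup UNIV) f \<in> K" using that by (rule m_inv_closed)
    moreover have "m_inv (BijGroup UNIV) f = finv f"
      using inv_BijGroup[OF bij[OF that]] by (simp add: restrict_def)
    ultimately show ?thesis by simp
  qed
  ultimately show ?thesis
    using bij' mult by (simp add: bij_group_def)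
qed

lemma bij_group_conj:
  fixes p :: "'a \<Rightarrow> 'a"
  assumes K: "bij_group K" and p: "bij p"
  shows "bij_group ((\<lambda>f. finv p \<circ> f \<circ> p) ` K)"
proof -
  have inv: "finv p (p x) = x" "p (finv p x) = x" for x
    using p by (simp_all add: bij_is_inj bij_is_surj surj_f_inv_f)
  have eq: "finv p \<circ> f \<circ> p \<circ> (finv p \<circ> g \<circ> p) = finv p \<circ> (f \<circ> g) \<circ> p" for f g
    by (auto simp: inv)
  have id: "finv p \<circ> id \<circ> p = id" by (auto simp: inv)
  have finv: "finv (finv p \<circ> f \<circ> p) = finv p \<circ> finv f \<circ> p" if "bij f" for f
  proof (rule inv_unique_comp)
    show "finv p \<circ> f \<circ> p \<circ> (finv p \<circ> finv f \<circ> p) = id" "finv p \<circ> finv f \<circ> p \<circ> (finv p \<circ> f \<circ> p) = id"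
      using that by (auto simp: inv fun_eq_iff bij_is_inj bij_is_surj surj_f_inv_f)
  qed
  show ?thesis
    unfolding bij_group_def
  proof (intro conjI ballI)
    show "id \<in> (\<lambda>f. finv p \<circ> f \<circ> p) ` K"
      using K id by (auto simp: bij_group_def image_iff intro!: bexI[of _ id])
  next
    fix f assume "f \<in> (\<lambda>f. finv p \<circ> f \<circ> p) ` K"
    then obtain f' where f': "f' \<in> K" "f = finv p \<circ> f' \<circ> p" by blast
    then have "bij f'" "finv f' \<in> K" using K by (auto simp: bij_group_def)
    then show "bij f" "finv f \<in> (\<lambda>f. finv p \<circ> f \<circ> p) ` K"
      using f' p finv by (auto intro!: bij_comp bij_imp_bij_inv)
  next
    fix f g assume "f \<in> (\<lambda>f. finv p \<circ> f \<circ> p) ` K" "g \<in> (\<lambda>f. finv p \<circ> f \<circ> p) ` K"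
    then obtain f' g' where fg: "f' \<in> K" "f = finv p \<circ> f' \<circ> p" "g' \<in> K" "g = finv p \<circ> g' \<circ> p" by blast
    then have "f' \<circ> g' \<in> K" using K by (auto simp: bij_group_def)
    then show "f \<circ> g \<in> (\<lambda>f. finv p \<circ> f \<circ> p) ` K"
      using eq fg by (auto simp: image_iff)
  qed
qed

text \<open>If conjugating back by \<open>phi\<close> keeps \<open>K\<close> inside F, the conjugate
  lies between \<open>H_group i\<close> and F and the induction hypothesis applies, shifting
  \<open>j\<close> by one. Otherwise \<open>K\<close> is F itself, that is
  \<open>H_group 0\<close>.\<close>

lemma overgroup_is_H_group:
  assumes "bij_group K" "H_group i \<subseteq> K" "K \<subseteq> thompson_F"
  shows "\<exists>j\<le>i. K = H_group j"
  using assms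
proof (induction i arbitrary: K)
  case 0
  then show ?case using H_group_0 by auto
next
  case (Suc i)
  show ?case
  proof (cases "\<forall>f\<in>K. pl_auto (finv phi \<circ> f \<circ> phi)")
    case False
    then have "K = thompson_F"
      using overgroup_eq_thompson_F Suc.prems by blast
    then show ?thesis using H_group_0 by auto
  next
    case True
    define K' where "K' = (\<lambda>f. finv phi \<circ> f \<circ> phi) ` K"
    have K: "K = (\<lambda>g. phi \<circ> g \<circ> finv phi) ` K'"
    proof -
      have "phi \<circ> (finv phi \<circ> f \<circ> phi) \<circ> finv phi = f" for f
        by (auto simp: order_auto_phi)
      then show ?thesis by (simp add: K'_def image_image)
    qed
    have "bij_group K'"
      unfolding K'_def by (rule bij_group_conj[OF Suc.prems(1) order_auto_bij[OF order_auto_phi]])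
    moreover have "K' \<subseteq> thompson_F"
      using True pl_auto_imp_thompson_F by (auto simp: K'_def)
    moreover have "H_group i \<subseteq> K'"
    proof
      fix g assume "g \<in> H_group i"
      then have "phi \<circ> g \<circ> finv phi \<in> K"
        using Suc.prems(2) H_group_Suc by blast
      moreover have "g = finv phi \<circ> (phi \<circ> g \<circ> finv phi) \<circ> phi"
        by (auto simp: order_auto_phi)
      ultimately show "g \<in> K'" unfolding K'_def by blast
    qed
    ultimately obtain j where "j \<le> i" "K' = H_group j"
      using Suc.IH by blast
    then have "Suc j \<le> Suc i \<and> K = H_group (Suc j)"
      using K H_group_Suc by simp
    then show ?thesis by blast
  qed
qed

theorem theorem6p6:
  fixes i :: nat and K :: "(cantor \<Rightarrow> cantor) set"
  assumes "subgroup K (BijGroup UNIV)"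
    and "H_group i \<subseteq> K"
    and "K \<subseteq> thompson_F"
  shows "\<exists>j\<le>i. K = H_group j"
  using bij_group_BijGroup[OF assms(1)] assms(2,3) by (rule overgroup_is_H_group)

end
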